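(* Let $[U_1,U_2]$ be an arbitrary interval with $U_2-U_1<2\sqrt{\pi}$. Let $W$ be a Gaussian space-time white noise on $\mathbb{R}\times[0,1]$, let $$x(u)=\int_0^1\int_{\mathbb{R}}p_{1-s}(u-v)\,W(dv,ds),\qquad u\in[U_1,U_2],$$ where $p_t(u)=\frac{1}{\sqrt{2\pi t}}e^{-\frac{u^2}{2t}}$ for $t>0$, $u\in\mathbb{R}$, and let $x_{U_1}(u)=x(u)-x(U_1)$, $u\in[U_1,U_2]$, which is a Gaussian integrator. Let $A$ be the continuous linear operator in $L_2([U_1,U_2])$ corresponding to the integrator $x_{U_1}$, that is, the operator in the representation $$x_{U_1}(u)=\big(A\mathbf{1}_{[U_1,u]},\xi\big),\qquad u\in[U_1,U_2],$$ where $\xi$ is a white noise in $L_2([U_1,U_2])$. Then the operator $A$ is continuously invertible.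
   Context: A Gaussian space-time white noise (Brownian sheet) $W$ on $\mathbb{R}\times[0,1]$ is a centered Gaussian random measure with independent values on disjoint sets and intensity Lebesgue measure, so that $E\big(\int_0^1\int_{\mathbb{R}} g\,dW\big)^2=\int_0^1\int_{\mathbb{R}} g(v,s)^2\,dv\,ds$ for $g\in L_2(\mathbb{R}\times[0,1])$. The process $x$ is the solution at time $t=1$ of the heat equation $\partial_t x=\frac12\partial_u^2x+W$ with zero initial condition. A white noise $\xi$ in a real Hilbert space $H$ is a centered Gaussian family $\{(h,\xi):h\in H\}$, linear in $h$, with $E\,(h,\xi)(g,\xi)=(h,g)_H$. $\mathbf{1}_{[U_1,u]}$ is the indicator function of $[U_1,u]$. A Gaussian integrator on $[U_1,U_2]$ is a centered Gaussian process $y$ with $y(U_1)=0$ for which there is $c>0$ such that $E\big(\sum_{k=0}^{n-1}a_k(y(u_{k+1})-y(u_k))\big)^2\le c\sum_{k=0}^{n-1}a_k^2(u_{k+1}-u_k)$ for every partition $U_1=u_0<\dots<u_n=U_2$ and all real $a_0,\dots,a_{n-1}$. A process is a Gaussian integrator if and only if it can be written as $y(u)=(A\mathbf{1}_{[U_1,u]},\xi)$ with a continuous linear operator $A$ in $L_2([U_1,U_2])$ and a white noise $\xi$ in the same space; $A$ is then called the operator corresponding to (generating) the integrator. For the integrator $x_{U_1}$ the operator $A$ satisfies, for any $f\in L_2([U_1,U_2])$ (extended by zero to $\mathbb{R}$), $$\|Af\|^2=\int_{\mathbb{R}}|\widehat f(\lambda)|^2(1-e^{-\lambda^2})\,d\lambda,\qquad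 \widehat f(\lambda)=\frac{1}{\sqrt{2\pi}}\int_{\mathbb{R}}f(y)e^{-i\lambda y}\,dy.$$
   Formalization: "Continuously invertible" is proved as: A is injective with continuous inverse on its range, and the range is all of L_2([U_1,U_2]) whenever it is dense; surjectivity fails for some A, since the representation fixes A only up to a left isometry. *)

theory Defs
  imports "HOL-Probability.Probability"
begin

section \<open>Square-integrable functions\<close>

text \<open>Elements of \<open>L\<^sub>2\<close> are handled through representatives; equality in \<open>L\<^sub>2\<close> is equality
  almost everywhere.\<close>

definition L2_space :: "'a measure \<Rightarrow> ('a \<Rightarrow> real) set" where
  "L2_space N = {f \<in> borel_measurable N. integrable N (\<lambda>x. (f x)\<^sup>2)}"

definition L2_inner :: "'a measure \<Rightarrow> ('a \<Rightarrow> real) \<Rightarrow> ('a \<Rightarrow> real) \<Rightarrow> real" where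
  "L2_inner N f g = (\<integral>x. f x * g x \<partial>N)"

definition L2_norm :: "'a measure \<Rightarrow> ('a \<Rightarrow> real) \<Rightarrow> real" where
  "L2_norm N f = sqrt (L2_inner N f f)"

abbreviation interval_lborel :: "real \<Rightarrow> real \<Rightarrow> real measure" where
  "interval_lborel a b \<equiv> restrict_space lborel {a..b}"

text \<open>Bounded (equivalently, continuous) linear maps into \<open>L\<^sub>2\<close>, defined on a linear subspace \<open>D\<close>
  of \<open>L\<^sub>2\<close>. The second clause makes \<open>T\<close> a map on classes.\<close>

definition bounded_linear_L2 ::
  "'a measure \<Rightarrow> ('a \<Rightarrow> real) set \<Rightarrow> (('a \<Rightarrow> real) \<Rightarrow> ('a \<Rightarrow> real)) \<Rightarrow> bool" where
  "bounded_linear_L2 N D T \<longleftrightarrow>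
     (\<forall>f\<in>D. T f \<in> L2_space N) \<and>
     (\<forall>f\<in>D. \<forall>g\<in>D. (AE x in N. f x = g x) \<longrightarrow> (AE x in N. T f x = T g x)) \<and>
     (\<forall>f\<in>D. \<forall>g\<in>D. AE x in N. T (\<lambda>y. f y + g y) x = T f x + T g x) \<and>
     (\<forall>c. \<forall>f\<in>D. AE x in N. T (\<lambda>y. c * f y) x = c * T f x) \<and>
     (\<exists>C. \<forall>f\<in>D. L2_norm N (T f) \<le> C * L2_norm N f)"

definition L2_range ::
  "'a measure \<Rightarrow> (('a \<Rightarrow> real) \<Rightarrow> ('a \<Rightarrow> real)) \<Rightarrow> ('a \<Rightarrow> real) set" where
  "L2_range N T = {g \<in> L2_space N. \<exists>f\<in>L2_space N. AE x in N. T f x = g x}"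

definition L2_dense :: "'a measure \<Rightarrow> ('a \<Rightarrow> real) set \<Rightarrow> bool" where
  "L2_dense N D \<longleftrightarrow> (\<forall>g\<in>L2_space N. \<forall>\<epsilon>>0. \<exists>f\<in>D. L2_norm N (\<lambda>x. f x - g x) < \<epsilon>)"

text \<open>The inverse operator has the range of \<open>T\<close> as its domain. Surjectivity of \<open>T\<close> is not part of
  the notion: an integrator determines its operator only up to an isometry on the left, and such an
  isometry may fail to be surjective.\<close>

definition continuously_invertible_L2 ::
  "'a measure \<Rightarrow> (('a \<Rightarrow> real) \<Rightarrow> ('a \<Rightarrow> real)) \<Rightarrow> bool" where
  "continuously_invertible_L2 N T \<longleftrightarrow>
     (\<exists>S. bounded_linear_L2 N (L2_range N T) S \<and>
          (\<forall>f\<in>L2_space N. AE x in N. S (T f) x = f x) \<and>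
          (\<forall>g\<in>L2_range N T. AE x in N. T (S g) x = g x))"


section \<open>Gaussian families and white noise\<close>

text \<open>The first alternative is the degenerate law with variance zero.\<close>

definition centered_gaussian :: "'w measure \<Rightarrow> ('w \<Rightarrow> real) \<Rightarrow> bool" where
  "centered_gaussian M X \<longleftrightarrow> X \<in> borel_measurable M \<and>
     ((AE \<omega> in M. X \<omega> = 0) \<or> (\<exists>\<sigma>>0. distributed M lborel X (normal_density 0 \<sigma>)))"

definition centered_gaussian_family ::
  "'w measure \<Rightarrow> 't set \<Rightarrow> ('t \<Rightarrow> 'w \<Rightarrow> real) \<Rightarrow> bool" where
  "centered_gaussian_family M I X \<longleftrightarrow>
     (\<forall>J c. finite J \<and> J \<subseteq> I \<longrightarrow> centered_gaussian M (\<lambda>\<omega>. \<Sum>t\<in>J. c t * X t \<omega>))"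

definition white_noise ::
  "'w measure \<Rightarrow> 'a measure \<Rightarrow> (('a \<Rightarrow> real) \<Rightarrow> 'w \<Rightarrow> real) \<Rightarrow> bool" where
  "white_noise M N \<xi> \<longleftrightarrow>
     centered_gaussian_family M (L2_space N) \<xi> \<and>
     (\<forall>f\<in>L2_space N. \<forall>g\<in>L2_space N. AE \<omega> in M. \<xi> (\<lambda>x. f x + g x) \<omega> = \<xi> f \<omega> + \<xi> g \<omega>) \<and>
     (\<forall>c. \<forall>f\<in>L2_space N. AE \<omega> in M. \<xi> (\<lambda>x. c * f x) \<omega> = c * \<xi> f \<omega>) \<and>
     (\<forall>f\<in>L2_space N. \<forall>g\<in>L2_space N. (\<integral>\<omega>. \<xi> f \<omega> * \<xi> g \<omega> \<partial>M) = L2_inner N f g)"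

definition finite_measure_sets :: "'s measure \<Rightarrow> 's set set" where
  "finite_measure_sets \<mu> = {B \<in> sets \<mu>. emeasure \<mu> B < \<infinity>}"

text \<open>Gaussian random measure with intensity \<open>\<mu>\<close>. Countable additivity (in mean square) follows
  from the four clauses.\<close>

definition gaussian_random_measure ::
  "'w measure \<Rightarrow> 's measure \<Rightarrow> ('s set \<Rightarrow> 'w \<Rightarrow> real) \<Rightarrow> bool" where
  "gaussian_random_measure M \<mu> W \<longleftrightarrow>
     centered_gaussian_family M (finite_measure_sets \<mu>) W \<and>
     (\<forall>B\<in>finite_measure_sets \<mu>. (\<integral>\<omega>. (W B \<omega>)\<^sup>2 \<partial>M) = measure \<mu> B) \<and>
     (\<forall>\<D>. \<D> \<subseteq> finite_measure_sets \<mu> \<and> disjoint \<D> \<longrightarrow>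
        prob_space.indep_vars M (\<lambda>_. borel) W \<D>) \<and>
     (\<forall>B\<in>finite_measure_sets \<mu>. \<forall>C\<in>finite_measure_sets \<mu>. B \<inter> C = {} \<longrightarrow>
        (AE \<omega> in M. W (B \<union> C) \<omega> = W B \<omega> + W C \<omega>))"

text \<open>\<open>has_noise_integral M \<mu> W g X\<close>: almost surely \<open>X = \<integral> g dW\<close>, that is, \<open>X\<close> is the mean square
  limit of the integrals of step functions converging to \<open>g\<close> in \<open>L\<^sub>2(\<mu>)\<close>.\<close>

definition has_noise_integral ::
  "'w measure \<Rightarrow> 's measure \<Rightarrow> ('s set \<Rightarrow> 'w \<Rightarrow> real) \<Rightarrow> ('s \<Rightarrow> real) \<Rightarrow> ('w \<Rightarrow> real) \<Rightarrow> bool"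
where
  "has_noise_integral M \<mu> W g X \<longleftrightarrow>
     g \<in> L2_space \<mu> \<and> X \<in> L2_space M \<and>
     (\<exists>(m :: nat \<Rightarrow> nat) (c :: nat \<Rightarrow> nat \<Rightarrow> real) (B :: nat \<Rightarrow> nat \<Rightarrow> 's set).
        (\<forall>k. \<forall>i<m k. B k i \<in> finite_measure_sets \<mu>) \<and>
        (\<lambda>k. L2_norm \<mu> (\<lambda>z. (\<Sum>i<m k. c k i * indicator (B k i) z) - g z)) \<longlonglongrightarrow> 0 \<and>
        (\<lambda>k. L2_norm M (\<lambda>\<omega>. (\<Sum>i<m k. c k i * W (B k i) \<omega>) - X \<omega>)) \<longlonglongrightarrow> 0)"

definition heat_kernel :: "real \<Rightarrow> real \<Rightarrow> real" where
  "heat_kernel t u = 1 / sqrt (2 * pi * t) * exp (- u\<^sup>2 / (2 * t))"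


section \<open>Gaussian integrators\<close>

definition gaussian_integrator ::
  "'w measure \<Rightarrow> real \<Rightarrow> real \<Rightarrow> (real \<Rightarrow> 'w \<Rightarrow> real) \<Rightarrow> bool" where
  "gaussian_integrator M a b y \<longleftrightarrow>
     centered_gaussian_family M {a..b} y \<and>
     (AE \<omega> in M. y a \<omega> = 0) \<and>
     (\<exists>c>0. \<forall>(n :: nat) (u :: nat \<Rightarrow> real) (\<alpha> :: nat \<Rightarrow> real).
        u 0 = a \<and> u n = b \<and> (\<forall>k<n. u k < u (Suc k)) \<longrightarrow>
        (\<integral>\<omega>. (\<Sum>k<n. \<alpha> k * (y (u (Suc k)) \<omega> - y (u k) \<omega>))\<^sup>2 \<partial>M)
          \<le> c * (\<Sum>k<n. (\<alpha> k)\<^sup>2 * (u (Suc k) - u k)))"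

text \<open>\<open>A\<close> is a continuous linear operator in \<open>L\<^sub>2([a, b])\<close> with \<open>y(u) = (A 1\<^bsub>[a, u]\<^esub>, \<xi>)\<close> almost surely,
  for every \<open>u \<in> [a, b]\<close> and some white noise \<open>\<xi>\<close> in \<open>L\<^sub>2([a, b])\<close>.\<close>

definition generates_integrator ::
  "'w measure \<Rightarrow> real \<Rightarrow> real \<Rightarrow> ((real \<Rightarrow> real) \<Rightarrow> (real \<Rightarrow> real)) \<Rightarrow> (real \<Rightarrow> 'w \<Rightarrow> real) \<Rightarrow> bool"
where
  "generates_integrator M a b A y \<longleftrightarrow>
     bounded_linear_L2 (interval_lborel a b) (L2_space (interval_lborel a b)) A \<and>
     (\<exists>\<xi>. white_noise M (interval_lborel a b) \<xi> \<and>
        (\<forall>u\<in>{a..b}. AE \<omega> in M. y u \<omega> = \<xi> (A (indicator {a..u})) \<omega>))"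

end

theory Submission
  imports Defs
begin

text \<open>For a step function \<open>f\<close> on \<open>[U\<^sub>1, U\<^sub>2]\<close>, integrating the increments of \<open>x\<close> against \<open>f\<close> gives a
  variable of second moment \<open>\<parallel>f\<parallel>\<^sup>2 - \<integral>\<integral> f(y) f(z) p\<^sub>2(y - z) dy dz\<close>, which is the spectral formula for
  \<open>\<parallel>Af\<parallel>\<^sup>2\<close> written in position space. Since \<open>p\<^sub>2 \<le> 1 / (2 \<surd>\<pi>)\<close>, the Cauchy-Schwarz inequality bounds the double
  integral by \<open>(U\<^sub>2 - U\<^sub>1) / (2 \<surd>\<pi>) \<parallel>f\<parallel>\<^sup>2\<close>, with a factor less than 1. Hence \<open>A\<close> is bounded below on step
  functions and, by density, on the whole of \<open>L\<^sub>2\<close>; this gives a bounded inverse on the range, which is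
  closed because \<open>L\<^sub>2\<close> is complete.\<close>

section \<open>The space of square-integrable functions\<close>

text \<open>The representation of the process gives direct access to the norm of \<open>A f\<close>
  only when \<open>f\<close> is a combination of indicators of intervals \<open>{U1..u}\<close>, so
  the estimate has to start there. In position space everything is explicit: the semigroup law turns
  a product of two kernels into \<open>heat_kernel (2 * (1 - s))\<close>, its time integral is
  elementary up to the error function, and the only non-smooth part of the covariance is the kink
  -\<bar>z\<bar> / 2. The kink produces the identity, the smooth rest a perturbation of it. The
  length 2 sqrt pi is the reciprocal of the maximum of the kernel, hence the length below which this
  perturbation bound stays under 1. The estimate is two-sided, and its upper half shows that the
  process is an integrator. As \<open>x\<close> is given only through mean square limits,
  Gaussianity must be carried through such limits as well, which is done with characteristic
  functions.\<close>

lemma L2_space_integrable_mult: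
  assumes "f \<in> L2_space N" "g \<in> L2_space N"
  shows "integrable N (\<lambda>x. f x * g x)"
proof (rule Bochner_Integration.integrable_bound)
  show "integrable N (\<lambda>x. (f x)\<^sup>2 + (g x)\<^sup>2)"
    using assms by (auto simp: L2_space_def)
  show "(\<lambda>x. f x * g x) \<in> borel_measurable N"
    using assms by (auto simp: L2_space_def)
  have "\<bar>a * b\<bar> \<le> a\<^sup>2 + b\<^sup>2" for a b :: real
  proof -
    have "0 \<le> (\<bar>a\<bar> - \<bar>b\<bar>)\<^sup>2" by simp
    then have "2 * (\<bar>a\<bar> * \<bar>b\<bar>) \<le> a\<^sup>2 + b\<^sup>2" by (simp add: power2_diff)
    moreover have "0 \<le> \<bar>a\<bar> * \<bar>b\<bar>" by simp
    ultimately show ?thesis unfolding abs_mult by linarith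
  qed
  then show "AE x in N. norm (f x * g x) \<le> norm ((f x)\<^sup>2 + (g x)\<^sup>2)"
    by (auto simp: abs_mult)
qed

lemma L2_space_measurable: "f \<in> L2_space N \<Longrightarrow> f \<in> borel_measurable N"
  by (simp add: L2_space_def)

lemma L2_space_add:
  assumes "f \<in> L2_space N" "g \<in> L2_space N"
  shows "(\<lambda>x. f x + g x) \<in> L2_space N"
  using L2_space_integrable_mult[OF assms] assms
  by (auto simp: L2_space_def power2_sum mult.assoc)

lemma L2_space_scale:
  assumes "f \<in> L2_space N"
  shows "(\<lambda>x. c * f x) \<in> L2_space N"
  using assms by (auto simp: L2_space_def power_mult_distrib)

lemma L2_space_diff:
  assumes "f \<in> L2_space N" "g \<in> L2_space N"
  shows "(\<lambda>x. f x - g x) \<in> L2_space N"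
  using L2_space_add[OF assms(1) L2_space_scale[OF assms(2), of "-1"]] by simp

lemma L2_space_zero: "(\<lambda>x. 0) \<in> L2_space N"
  by (simp add: L2_space_def)

lemma L2_space_sum:
  assumes "\<And>i. i \<in> I \<Longrightarrow> f i \<in> L2_space N"
  shows "(\<lambda>x. \<Sum>i\<in>I. f i x) \<in> L2_space N"
  using assms by (induction I rule: infinite_finite_induct) (auto intro: L2_space_zero L2_space_add)

lemma L2_space_indicator:
  assumes "B \<in> sets N" "emeasure N B < \<infinity>"
  shows "indicator B \<in> L2_space N"
  using assms by (auto simp: L2_space_def power2_eq_square indicator_inter_arith[symmetric])

lemma L2_inner_commute: "L2_inner N f g = L2_inner N g f"
  by (simp add: L2_inner_def mult.commute)

lemma L2_inner_sum_left:
  assumes "\<And>i. i \<in> I \<Longrightarrow> f i \<in> L2_space N" "g \<in> L2_space N"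
  shows "L2_inner N (\<lambda>x. \<Sum>i\<in>I. c i * f i x) g = (\<Sum>i\<in>I. c i * L2_inner N (f i) g)"
proof -
  have "L2_inner N (\<lambda>x. \<Sum>i\<in>I. c i * f i x) g = (\<integral>x. (\<Sum>i\<in>I. c i * (f i x * g x)) \<partial>N)"
    by (simp add: L2_inner_def sum_distrib_right mult.assoc)
  also have "\<dots> = (\<Sum>i\<in>I. \<integral>x. c i * (f i x * g x) \<partial>N)"
    by (rule Bochner_Integration.integral_sum) (use assms L2_space_integrable_mult in auto)
  also have "\<dots> = (\<Sum>i\<in>I. c i * L2_inner N (f i) g)"
    by (simp add: L2_inner_def)
  finally show ?thesis .
qed

lemma L2_inner_sum_sum:
  assumes "\<And>i. i \<in> I \<Longrightarrow> f i \<in> L2_space N" 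
  shows "L2_inner N (\<lambda>x. \<Sum>i\<in>I. c i * f i x) (\<lambda>x. \<Sum>i\<in>I. c i * f i x)
    = (\<Sum>i\<in>I. \<Sum>j\<in>I. c i * c j * L2_inner N (f i) (f j))"
proof -
  have s: "(\<lambda>x. \<Sum>i\<in>I. c i * f i x) \<in> L2_space N"
    by (intro L2_space_sum L2_space_scale assms)
  have "L2_inner N (f i) (\<lambda>x. \<Sum>i\<in>I. c i * f i x) = (\<Sum>j\<in>I. c j * L2_inner N (f i) (f j))"
    if "i \<in> I" for i
    unfolding L2_inner_commute[of N "f i"] by (rule L2_inner_sum_left) (use assms that in auto)
  then show ?thesis
    by (subst L2_inner_sum_left) (auto simp: assms s sum_distrib_left mult.assoc intro!: sum.cong)
qed

lemma L2_inner_self_nonneg: "0 \<le> L2_inner N f f"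
  by (simp add: L2_inner_def)

lemma L2_norm_nonneg: "0 \<le> L2_norm N f"
  by (simp add: L2_norm_def L2_inner_self_nonneg)

lemma L2_norm_sq: "(L2_norm N f)\<^sup>2 = L2_inner N f f"
  by (simp add: L2_norm_def L2_inner_self_nonneg)

lemma nn_integral_power2_eq_L2_norm:
  assumes "f \<in> L2_space N"
  shows "(\<integral>\<^sup>+x. ennreal ((f x)\<^sup>2) \<partial>N) = ennreal ((L2_norm N f)\<^sup>2)"
  unfolding L2_norm_sq L2_inner_def power2_eq_square[symmetric]
  by (rule nn_integral_eq_integral) (use assms in \<open>auto simp: L2_space_def\<close>)

lemma L2_inner_cong_AE:
  assumes "f \<in> borel_measurable N" "f' \<in> borel_measurable N"
    "g \<in> borel_measurable N" "g' \<in> borel_measurable N"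
    "AE x in N. f x = f' x" "AE x in N. g x = g' x"
  shows "L2_inner N f g = L2_inner N f' g'"
  unfolding L2_inner_def using assms by (intro integral_cong_AE) auto

lemma L2_norm_cong_AE:
  assumes "f \<in> borel_measurable N" "g \<in> borel_measurable N" "AE x in N. f x = g x"
  shows "L2_norm N f = L2_norm N g"
  unfolding L2_norm_def using L2_inner_cong_AE assms by metis

lemma L2_norm_eq_0_AE:
  assumes "f \<in> L2_space N" "L2_norm N f = 0"
  shows "AE x in N. f x = 0"
proof -
  have "(\<integral>x. (f x)\<^sup>2 \<partial>N) = 0" "integrable N (\<lambda>x. (f x)\<^sup>2)"
    using assms by (auto simp: L2_norm_def L2_inner_def power2_eq_square L2_space_def)
  then have "AE x in N. (f x)\<^sup>2 = 0"
    by (subst (asm) integral_nonneg_eq_0_iff_AE) auto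
  then show ?thesis by simp
qed

lemma L2_inner_add_self:
  assumes "f \<in> L2_space N" "g \<in> L2_space N"
  shows "L2_inner N (\<lambda>x. f x + c * g x) (\<lambda>x. f x + c * g x)
    = L2_inner N f f + 2 * c * L2_inner N f g + c\<^sup>2 * L2_inner N g g"
proof -
  note [simp] = L2_space_integrable_mult[OF assms] L2_space_integrable_mult[OF assms(1,1)]
    L2_space_integrable_mult[OF assms(2,2)]
  have "L2_inner N (\<lambda>x. f x + c * g x) (\<lambda>x. f x + c * g x)
    = (\<integral>x. f x * f x + (2 * c * (f x * g x) + c\<^sup>2 * (g x * g x)) \<partial>N)"
    unfolding L2_inner_def by (intro Bochner_Integration.integral_cong) (auto simp: algebra_simps power2_eq_square)
  also have "\<dots> = L2_inner N f f + (2 * c * L2_inner N f g + c\<^sup>2 * L2_inner N g g)"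
    by (simp add: L2_inner_def)
  finally show ?thesis by simp
qed

lemma L2_Cauchy_Schwarz:
  assumes "f \<in> L2_space N" "g \<in> L2_space N"
  shows "\<bar>L2_inner N f g\<bar> \<le> L2_norm N f * L2_norm N g"
proof -
  let ?a = "L2_inner N f f" and ?b = "L2_inner N f g" and ?c = "L2_inner N g g"
  have q: "0 \<le> ?a + 2 * t * ?b + t\<^sup>2 * ?c" for t
    using L2_inner_self_nonneg[of N "\<lambda>x. f x + t * g x"] L2_inner_add_self[OF assms, of t] by simp
  have "?b\<^sup>2 \<le> ?a * ?c"
  proof (cases "?c = 0")
    case True
    have "?b = 0"
    proof (rule ccontr)
      assume "?b \<noteq> 0"
      \<comment> \<open>At this \<open>t\<close> the expression \<open>?a + 2 * t * ?b\<close>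
        equals -1.\<close>
      then show False
        using q[of "- (?a + 1) / (2 * ?b)"] True by (simp add: field_simps)
    qed
    then show ?thesis using True by simp
  next
    case False
    then have c: "0 < ?c" using L2_inner_self_nonneg[of N g] by linarith
    \<comment> \<open>The quadratic in \<open>t\<close> is minimal at \<open>- ?b / ?c\<close>;
      multiplied by \<open>?c\<close>, its minimum is the discriminant expression.\<close>
    have "0 \<le> (?a + 2 * (- ?b / ?c) * ?b + (- ?b / ?c)\<^sup>2 * ?c) * ?c"
      using q[of "- ?b / ?c"] c by simp
    also have "\<dots> = ?a * ?c - ?b\<^sup>2"
      using c by (simp add: field_simps power2_eq_square)
    finally show ?thesis by simp
  qed
  then have "?b\<^sup>2 \<le> (L2_norm N f * L2_norm N g)\<^sup>2"
    by (simp add: power_mult_distrib L2_norm_sq)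
  then show ?thesis
    by (metis L2_norm_nonneg abs_le_square_iff abs_of_nonneg mult_nonneg_nonneg)
qed

lemma L2_norm_triangle:
  assumes "f \<in> L2_space N" "g \<in> L2_space N"
  shows "L2_norm N (\<lambda>x. f x + g x) \<le> L2_norm N f + L2_norm N g"
proof (rule power2_le_imp_le)
  have "(L2_norm N (\<lambda>x. f x + g x))\<^sup>2 = (L2_norm N f)\<^sup>2 + 2 * L2_inner N f g + (L2_norm N g)\<^sup>2"
    unfolding L2_norm_sq using L2_inner_add_self[OF assms, of 1] by simp
  also have "\<dots> \<le> (L2_norm N f + L2_norm N g)\<^sup>2"
    using L2_Cauchy_Schwarz[OF assms] by (simp add: power2_sum)
  finally show "(L2_norm N (\<lambda>x. f x + g x))\<^sup>2 \<le> (L2_norm N f + L2_norm N g)\<^sup>2" .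
  show "0 \<le> L2_norm N f + L2_norm N g" by (simp add: L2_norm_nonneg)
qed

lemma L2_norm_scale: "L2_norm N (\<lambda>x. c * f x) = \<bar>c\<bar> * L2_norm N f"
proof -
  have "L2_inner N (\<lambda>x. c * f x) (\<lambda>x. c * f x) = (\<integral>x. c\<^sup>2 * (f x * f x) \<partial>N)"
    unfolding L2_inner_def by (simp add: power2_eq_square mult.assoc mult.left_commute)
  also have "\<dots> = c\<^sup>2 * L2_inner N f f" by (simp add: L2_inner_def)
  finally show ?thesis by (simp add: L2_norm_def real_sqrt_mult)
qed

lemma L2_norm_minus_commute: "L2_norm N (\<lambda>x. f x - g x) = L2_norm N (\<lambda>x. g x - f x)"
  using L2_norm_scale[of N "-1" "\<lambda>x. f x - g x"] by simp

lemma L2_norm_diff_triangle: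
  assumes "f \<in> L2_space N" "g \<in> L2_space N" "h \<in> L2_space N"
  shows "L2_norm N (\<lambda>x. f x - h x) \<le> L2_norm N (\<lambda>x. f x - g x) + L2_norm N (\<lambda>x. g x - h x)"
  using L2_norm_triangle[OF L2_space_diff[OF assms(1,2)] L2_space_diff[OF assms(2,3)]] by simp

lemma L2_norm_reverse_triangle:
  assumes "f \<in> L2_space N" "g \<in> L2_space N"
  shows "\<bar>L2_norm N f - L2_norm N g\<bar> \<le> L2_norm N (\<lambda>x. f x - g x)"
  using L2_norm_triangle[OF L2_space_diff[OF assms] assms(2)]
    L2_norm_triangle[OF L2_space_diff[OF assms(2,1)] assms(1)] L2_norm_minus_commute[of N f g]
  by simp

lemma L2_norm_tendsto:
  assumes "\<And>k. f k \<in> L2_space N" "g \<in> L2_space N"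
    and "(\<lambda>k. L2_norm N (\<lambda>x. f k x - g x)) \<longlonglongrightarrow> 0"
  shows "(\<lambda>k. L2_norm N (f k)) \<longlonglongrightarrow> L2_norm N g"
proof -
  have "(\<lambda>k. L2_norm N (f k) - L2_norm N g) \<longlonglongrightarrow> 0"
    by (rule Lim_null_comparison[OF _ assms(3)])
      (use L2_norm_reverse_triangle[OF assms(1,2)] in auto)
  then show ?thesis by (simp add: LIM_zero_iff)
qed

text \<open>Cauchy-Schwarz against the constant 1. On an interval the factor is the square root of
  the length, which is how the length enters the final threshold; on a probability space the factor
  is 1.\<close>

lemma integral_abs_le_L2_norm:
  assumes "finite_measure N" "f \<in> L2_space N"
  shows "integrable N f" "(\<integral>x. \<bar>f x\<bar> \<partial>N) \<le> sqrt (measure N (space N)) * L2_norm N f"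
proof -
  interpret finite_measure N by fact
  have one: "(\<lambda>x. 1) \<in> L2_space N" by (simp add: L2_space_def)
  have abs: "(\<lambda>x. \<bar>f x\<bar>) \<in> L2_space N" using assms(2) by (auto simp: L2_space_def)
  show "integrable N f" using L2_space_integrable_mult[OF one assms(2)] by simp
  have "(\<integral>x. \<bar>f x\<bar> \<partial>N) \<le> L2_norm N (\<lambda>x. 1) * L2_norm N (\<lambda>x. \<bar>f x\<bar>)"
    using L2_Cauchy_Schwarz[OF one abs] by (simp add: L2_inner_def)
  then show "(\<integral>x. \<bar>f x\<bar> \<partial>N) \<le> sqrt (measure N (space N)) * L2_norm N f"
    by (simp add: L2_norm_def L2_inner_def)
qed

text \<open>Riesz-Fischer. On a finite measure an L2 Cauchy sequence is L1 Cauchy, so a subsequence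
  converges almost everywhere; Fatou's lemma along it turns the Cauchy bounds into bounds on the
  distance to the limit, and thereby shows that the limit is square integrable.\<close>

lemma L2_complete:
  fixes f :: "nat \<Rightarrow> 'a \<Rightarrow> real"
  assumes "finite_measure N" and f: "\<And>n. f n \<in> L2_space N"
    and cauchy: "\<And>e. e > 0 \<Longrightarrow> \<exists>K. \<forall>i\<ge>K. \<forall>j\<ge>K. L2_norm N (\<lambda>x. f i x - f j x) < e"
  shows "\<exists>g\<in>L2_space N. (\<lambda>n. L2_norm N (\<lambda>x. f n x - g x)) \<longlonglongrightarrow> 0"
proof -
  interpret finite_measure N by fact
  have [measurable]: "f n \<in> borel_measurable N" for n using f L2_space_measurable by auto
  \<comment> \<open>The added 1 keeps the factor positive even if the whole space is null, so that
    one can divide by it.\<close>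
  let ?s = "sqrt (measure N (space N)) + 1"
  have s: "?s > 0" by (simp add: add_nonneg_pos)
  have "\<exists>K. \<forall>i\<ge>K. \<forall>j\<ge>K. (\<integral>x. norm (f i x - f j x) \<partial>N) < e" if e: "e > 0" for e
  proof -
    obtain K where K: "\<forall>i\<ge>K. \<forall>j\<ge>K. L2_norm N (\<lambda>x. f i x - f j x) < e / ?s"
      using cauchy[OF divide_pos_pos[OF e s]] by blast
    have "(\<integral>x. norm (f i x - f j x) \<partial>N) < e" if "i \<ge> K" "j \<ge> K" for i j
    proof -
      have "(\<integral>x. norm (f i x - f j x) \<partial>N) \<le> ?s * L2_norm N (\<lambda>x. f i x - f j x)"
        using integral_abs_le_L2_norm(2)[OF assms(1) L2_space_diff[OF f f], of i j]
          L2_norm_nonneg[of N "\<lambda>x. f i x - f j x"] by (simp add: distrib_right)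
      also have "\<dots> < ?s * (e / ?s)"
        using K that s by (intro mult_strict_left_mono) auto
      finally show ?thesis using s by simp
    qed
    then show ?thesis by blast
  qed
  then obtain r where r: "strict_mono r" and ae: "AE x in N. Cauchy (\<lambda>i. f (r i) x)"
    using cauchy_L1_AE_cauchy_subseq[of N f] integral_abs_le_L2_norm(1)[OF assms(1) f] by metis
  define g where "g x = lim (\<lambda>i. f (r i) x)" for x
  have [measurable]: "g \<in> borel_measurable N" unfolding g_def[abs_def] by measurable
  have lim: "AE x in N. (\<lambda>i. f (r i) x) \<longlonglongrightarrow> g x"
    using ae by eventually_elim (simp add: g_def Cauchy_convergent_iff convergent_LIMSEQ_iff)
  have fatou: "(\<integral>\<^sup>+x. ennreal ((f n x - g x)\<^sup>2) \<partial>N) \<le> ennreal (e\<^sup>2)"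
    if n: "\<forall>j\<ge>n. L2_norm N (\<lambda>x. f n x - f j x) < e" for n e
  proof -
    have "(\<integral>\<^sup>+x. ennreal ((f n x - g x)\<^sup>2) \<partial>N)
      = (\<integral>\<^sup>+x. liminf (\<lambda>i. ennreal ((f n x - f (r i) x)\<^sup>2)) \<partial>N)"
    proof (rule nn_integral_cong_AE, use lim in eventually_elim)
      fix x assume "(\<lambda>i. f (r i) x) \<longlonglongrightarrow> g x"
      then have "(\<lambda>i. ennreal ((f n x - f (r i) x)\<^sup>2)) \<longlonglongrightarrow> ennreal ((f n x - g x)\<^sup>2)"
        by (intro tendsto_ennrealI tendsto_intros)
      then show "ennreal ((f n x - g x)\<^sup>2) = liminf (\<lambda>i. ennreal ((f n x - f (r i) x)\<^sup>2))"
        by (metis lim_imp_Liminf sequentially_bot)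
    qed
    also have "\<dots> \<le> liminf (\<lambda>i. \<integral>\<^sup>+x. ennreal ((f n x - f (r i) x)\<^sup>2) \<partial>N)"
      by (rule nn_integral_liminf) measurable
    also have "\<dots> \<le> ennreal (e\<^sup>2)"
    proof (rule Liminf_le)
      have "(\<integral>\<^sup>+x. ennreal ((f n x - f (r i) x)\<^sup>2) \<partial>N) \<le> ennreal (e\<^sup>2)" if "i \<ge> n" for i
      proof -
        have "(\<integral>\<^sup>+x. ennreal ((f n x - f (r i) x)\<^sup>2) \<partial>N)
          = ennreal ((L2_norm N (\<lambda>x. f n x - f (r i) x))\<^sup>2)"
          by (rule nn_integral_power2_eq_L2_norm[OF L2_space_diff[OF f f]])
        also have "\<dots> \<le> ennreal (e\<^sup>2)"
          \<comment> \<open>\<open>r i \<ge> i \<ge> n\<close>, so the bound valid from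
            \<open>n\<close> on applies along the subsequence.\<close>
          using n that seq_suble[OF r, of i]
          by (intro ennreal_leI power_mono L2_norm_nonneg) (meson le_trans less_imp_le)
        finally show ?thesis .
      qed
      then show "\<forall>\<^sub>F i in sequentially. (\<integral>\<^sup>+x. ennreal ((f n x - f (r i) x)\<^sup>2) \<partial>N) \<le> ennreal (e\<^sup>2)"
        by (auto simp: eventually_sequentially)
    qed simp
    finally show ?thesis .
  qed
  have diff: "(\<lambda>x. f n x - g x) \<in> L2_space N"
    if n: "\<forall>j\<ge>n. L2_norm N (\<lambda>x. f n x - f j x) < e" for n e
    using fatou[OF n] by (auto simp: L2_space_def integrable_iff_bounded intro: le_less_trans)
  obtain K where "\<forall>i\<ge>K. \<forall>j\<ge>K. L2_norm N (\<lambda>x. f i x - f j x) < 1"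
    using cauchy[of 1] by auto
  then have "\<forall>j\<ge>K. L2_norm N (\<lambda>x. f K x - f j x) < 1" by blast
  from L2_space_diff[OF f diff[OF this], of K] have g: "g \<in> L2_space N" by simp
  have "(\<lambda>n. L2_norm N (\<lambda>x. f n x - g x)) \<longlonglongrightarrow> 0"
  proof (rule LIMSEQ_I)
    fix e :: real assume e: "0 < e"
    obtain K where K: "\<forall>i\<ge>K. \<forall>j\<ge>K. L2_norm N (\<lambda>x. f i x - f j x) < e / 2"
      using cauchy[of "e / 2"] e by auto
    have "L2_norm N (\<lambda>x. f n x - g x) \<le> e / 2" if "n \<ge> K" for n
    proof -
      have "\<forall>j\<ge>n. L2_norm N (\<lambda>x. f n x - f j x) < e / 2" using K that by auto
      from fatou[OF this] have "ennreal ((L2_norm N (\<lambda>x. f n x - g x))\<^sup>2) \<le> ennreal ((e / 2)\<^sup>2)"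
        unfolding nn_integral_power2_eq_L2_norm[OF L2_space_diff[OF f g]] .
      then have "(L2_norm N (\<lambda>x. f n x - g x))\<^sup>2 \<le> (e / 2)\<^sup>2" by (subst (asm) ennreal_le_iff) auto
      then show ?thesis by (rule power2_le_imp_le) (use e in simp)
    qed
    then have "norm (L2_norm N (\<lambda>x. f n x - g x) - 0) < e" if "n \<ge> K" for n
      using e that L2_norm_nonneg[of N "\<lambda>x. f n x - g x"] by fastforce
    then show "\<exists>K. \<forall>n\<ge>K. norm (L2_norm N (\<lambda>x. f n x - g x) - 0) < e" by blast
  qed
  with g show ?thesis by blast
qed

section \<open>Gaussian limits and noise integrals\<close>

context prob_space
begin

lemma centered_gaussian_L2:
  assumes "centered_gaussian M X"
  shows "X \<in> L2_space M"
proof -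
  have [measurable]: "X \<in> borel_measurable M" using assms by (simp add: centered_gaussian_def)
  consider "AE \<omega> in M. X \<omega> = 0"
    | \<sigma> where "\<sigma> > 0" "distributed M lborel X (normal_density 0 \<sigma>)"
    using assms by (auto simp: centered_gaussian_def)
  then have "integrable M (\<lambda>\<omega>. (X \<omega>)\<^sup>2)"
  proof cases
    case 1
    then have "AE \<omega> in M. (X \<omega>)\<^sup>2 = 0" by auto
    then show ?thesis by (subst integrable_cong_AE[where g = "\<lambda>_. 0"]) auto
  next
    case 2
    show ?thesis
      by (rule iffD1[OF distributed_integrable[OF 2(2)]])
        (use integrable_normal_moment[OF 2(1), where \<mu> = 0 and k = 2] in auto)
  qed
  then show ?thesis by (simp add: L2_space_def)
qed

text \<open>Expressed through the second moment, the formula covers the degenerate law as well; in a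
  limit only the second moments then have to be followed.\<close>

lemma char_distr_centered_gaussian:
  assumes "centered_gaussian M X"
  shows "char (distr M borel X) t = complex_of_real (exp (- (t\<^sup>2 * L2_inner M X X) / 2))"
proof -
  have [measurable]: "X \<in> borel_measurable M" using assms by (simp add: centered_gaussian_def)
  consider "AE \<omega> in M. X \<omega> = 0"
    | \<sigma> where "\<sigma> > 0" "distributed M lborel X (normal_density 0 \<sigma>)"
    using assms by (auto simp: centered_gaussian_def)
  then show ?thesis
  proof cases
    case 1
    have "char (distr M borel X) t = (\<integral>\<omega>. iexp (t * X \<omega>) \<partial>M)"
      unfolding char_def by (subst integral_distr) auto
    also have "\<dots> = (\<integral>\<omega>. 1 \<partial>M)"
      by (rule integral_cong_AE) (use 1 in auto)
    also have "\<dots> = 1" by (simp add: prob_space)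
    finally have c: "char (distr M borel X) t = 1" .
    have "L2_inner M X X = 0"
      unfolding L2_inner_def by (subst integral_cong_AE[where g = "\<lambda>_. 0"]) (use 1 in auto)
    with c show ?thesis by simp
  next
    case 2
    let ?Y = "\<lambda>\<omega>. X \<omega> / \<sigma>"
    have D: "distributed M lborel ?Y std_normal_density"
      using normal_standard_normal_convert[OF 2(1), of X 0] 2(2) by simp
    then have "distr M borel ?Y = std_normal_distribution"
      unfolding distributed_def by (metis distr_cong sets_lborel)
    then have "char (distr M borel ?Y) (\<sigma> * t) = complex_of_real (exp (- ((\<sigma> * t)\<^sup>2) / 2))"
      by (simp add: char_std_normal_distribution)
    moreover have "char (distr M borel ?Y) (\<sigma> * t) = char (distr M borel X) t"
      unfolding char_def using 2(1) by (simp add: integral_distr)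
    moreover have "L2_inner M X X = \<sigma>\<^sup>2"
      using normal_distributed_variance[OF 2] normal_distributed_expectation[OF 2]
      by (simp add: L2_inner_def power2_eq_square)
    ultimately show ?thesis by (simp add: power_mult_distrib mult.commute)
  qed
qed

text \<open>The map s -> exp (i s) is 1-Lipschitz, and on a probability space the L1 norm is at most
  the L2 norm. Mean square convergence thus gives pointwise convergence of characteristic
  functions.\<close>

lemma cmod_char_diff_le:
  assumes "X \<in> L2_space M" "Y \<in> L2_space M"
  shows "cmod (char (distr M borel X) t - char (distr M borel Y) t)
    \<le> \<bar>t\<bar> * L2_norm M (\<lambda>\<omega>. X \<omega> - Y \<omega>)"
proof -
  have [measurable]: "X \<in> borel_measurable M" "Y \<in> borel_measurable M"
    using assms L2_space_measurable by auto
  have lip: "cmod (iexp a - iexp b) \<le> \<bar>a - b\<bar>" for a b :: real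
  proof -
    have "iexp a - iexp b = iexp b * (iexp (a - b) - 1)"
      by (simp add: exp_diff right_diff_distrib)
    then have "cmod (iexp a - iexp b) = cmod (iexp (a - b) - 1)" by (simp add: norm_mult)
    then show ?thesis using iexp_approx1[of "a - b" 0] by simp
  qed
  have i: "integrable M (\<lambda>\<omega>. iexp (t * Z \<omega>))" if [measurable]: "Z \<in> borel_measurable M" for Z
    by (intro integrable_const_bound[where B = 1]) auto
  have "char (distr M borel X) t - char (distr M borel Y) t
    = (\<integral>\<omega>. iexp (t * X \<omega>) - iexp (t * Y \<omega>) \<partial>M)"
    unfolding char_def using i[of X] i[of Y] by (simp add: integral_distr)
  also have "cmod \<dots> \<le> (\<integral>\<omega>. cmod (iexp (t * X \<omega>) - iexp (t * Y \<omega>)) \<partial>M)"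
    by (rule integral_norm_bound)
  also have "\<dots> \<le> (\<integral>\<omega>. \<bar>t\<bar> * \<bar>X \<omega> - Y \<omega>\<bar> \<partial>M)"
  proof (rule integral_mono)
    show "integrable M (\<lambda>\<omega>. cmod (iexp (t * X \<omega>) - iexp (t * Y \<omega>)))"
      by (intro integrable_norm Bochner_Integration.integrable_diff i) auto
    show "integrable M (\<lambda>\<omega>. \<bar>t\<bar> * \<bar>X \<omega> - Y \<omega>\<bar>)"
      using integral_abs_le_L2_norm(1)[OF finite_measure_axioms L2_space_diff[OF assms]] by simp
    show "cmod (iexp (t * X \<omega>) - iexp (t * Y \<omega>)) \<le> \<bar>t\<bar> * \<bar>X \<omega> - Y \<omega>\<bar>" for \<omega>
      using lip[of "t * X \<omega>" "t * Y \<omega>"] by (simp add: abs_mult[symmetric] right_diff_distrib)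
  qed
  also have "\<dots> \<le> \<bar>t\<bar> * L2_norm M (\<lambda>\<omega>. X \<omega> - Y \<omega>)"
    using integral_abs_le_L2_norm(2)[OF finite_measure_axioms L2_space_diff[OF assms]]
    by (simp add: prob_space mult_left_mono)
  finally show ?thesis .
qed

text \<open>Second moments and characteristic functions converge together, so the limit has the
  characteristic function of the centered Gaussian with its own second moment as variance, and a law
  is determined by its characteristic function. Variance zero is split off because that law has no
  density.\<close>

lemma centered_gaussian_L2_limit:
  assumes X: "\<And>k. centered_gaussian M (X k)" and Y: "Y \<in> L2_space M"
    and lim: "(\<lambda>k. L2_norm M (\<lambda>\<omega>. X k \<omega> - Y \<omega>)) \<longlonglongrightarrow> 0"
  shows "centered_gaussian M Y"
proof -
  have XL: "X k \<in> L2_space M" for k by (rule centered_gaussian_L2[OF X])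
  have [measurable]: "Y \<in> borel_measurable M" using Y L2_space_measurable by auto
  let ?s = "L2_inner M Y Y"
  have s: "(\<lambda>k. L2_inner M (X k) (X k)) \<longlonglongrightarrow> ?s"
    using tendsto_power[OF L2_norm_tendsto[OF XL Y lim], of 2] by (simp add: L2_norm_sq)
  have char: "char (distr M borel Y) t = complex_of_real (exp (- (t\<^sup>2 * ?s) / 2))" for t
  proof (rule LIMSEQ_unique)
    have "(\<lambda>k. char (distr M borel (X k)) t - char (distr M borel Y) t) \<longlonglongrightarrow> 0"
    proof (rule Lim_null_comparison)
      show "\<forall>\<^sub>F k in sequentially. cmod (char (distr M borel (X k)) t - char (distr M borel Y) t)
          \<le> \<bar>t\<bar> * L2_norm M (\<lambda>\<omega>. X k \<omega> - Y \<omega>)"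
        using cmod_char_diff_le[OF XL Y] by simp
      show "(\<lambda>k. \<bar>t\<bar> * L2_norm M (\<lambda>\<omega>. X k \<omega> - Y \<omega>)) \<longlonglongrightarrow> 0"
        using tendsto_mult_left[OF lim, of "\<bar>t\<bar>"] by simp
    qed
    then show "(\<lambda>k. char (distr M borel (X k)) t) \<longlonglongrightarrow> char (distr M borel Y) t"
      by (simp add: LIM_zero_iff)
    show "(\<lambda>k. char (distr M borel (X k)) t) \<longlonglongrightarrow> complex_of_real (exp (- (t\<^sup>2 * ?s) / 2))"
      unfolding char_distr_centered_gaussian[OF X] by (intro tendsto_intros s) simp
  qed
  show ?thesis
  proof (cases "?s = 0")
    case True
    then have "AE \<omega> in M. Y \<omega> = 0" using L2_norm_eq_0_AE[OF Y] by (simp add: L2_norm_def)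
    then show ?thesis by (simp add: centered_gaussian_def)
  next
    case False
    define \<sigma> where "\<sigma> = L2_norm M Y"
    have \<sigma>: "\<sigma> > 0" "\<sigma>\<^sup>2 = ?s"
      using False L2_inner_self_nonneg[of M Y] by (auto simp: \<sigma>_def L2_norm_def)
    let ?Z = "\<lambda>\<omega>. Y \<omega> / \<sigma>"
    have "distr M borel ?Z = std_normal_distribution"
    proof (rule Levy_uniqueness)
      show "real_distribution (distr M borel ?Z)"
        by (rule real_distribution_distr) simp
      show "real_distribution std_normal_distribution"
        by (rule real_dist_normal_dist)
      show "char (distr M borel ?Z) = char std_normal_distribution"
      proof
        fix t
        have "char (distr M borel ?Z) t = char (distr M borel Y) (t / \<sigma>)"
          unfolding char_def by (simp add: integral_distr)
        also have "\<dots> = char std_normal_distribution t"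
          unfolding char char_std_normal_distribution
          using \<sigma> by (simp add: \<sigma>(2)[symmetric] power_divide)
        finally show "char (distr M borel ?Z) t = char std_normal_distribution t" .
      qed
    qed
    then have "distributed M lborel ?Z std_normal_density"
      unfolding distributed_def by (auto cong: distr_cong)
    then have "distributed M lborel Y (normal_density 0 \<sigma>)"
      using normal_standard_normal_convert[OF \<sigma>(1), of Y 0] by simp
    with \<sigma>(1) show ?thesis by (auto simp: centered_gaussian_def)
  qed
qed

end

section \<open>Integrals against a Gaussian random measure\<close>

lemma sum_lessThan_append:
  "(\<Sum>i<m + n. if i < m then f i else g (i - m)) = (\<Sum>i<m. f i) + (\<Sum>i<n. g i)"
  for f g :: "nat \<Rightarrow> 'a::comm_monoid_add"
  by (induction n) (auto simp: add.assoc)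

lemma has_noise_integral_zero: "has_noise_integral M \<mu> W (\<lambda>_. 0) (\<lambda>_. 0)"
  unfolding has_noise_integral_def
  by (intro conjI L2_space_zero exI[of _ "\<lambda>_. 0"]) (auto simp: L2_norm_def L2_inner_def)

lemma has_noise_integralE:
  assumes "has_noise_integral M \<mu> W g X"
  obtains m c B where "\<And>k i. i < (m k :: nat) \<Longrightarrow> B k i \<in> finite_measure_sets \<mu>"
    "(\<lambda>k. L2_norm \<mu> (\<lambda>z. (\<Sum>i<m k. c k i * indicator (B k i) z) - g z)) \<longlonglongrightarrow> 0"
    "(\<lambda>k. L2_norm M (\<lambda>\<omega>. (\<Sum>i<m k. c k i * W (B k i) \<omega>) - X \<omega>)) \<longlonglongrightarrow> 0"
    "g \<in> L2_space \<mu>" "X \<in> L2_space M"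
  using assms unfolding has_noise_integral_def by (elim conjE exE) (rule that, auto)

locale gaussian_measure = prob_space M for M :: "'w measure" +
  fixes \<mu> :: "'s measure" and W :: "'s set \<Rightarrow> 'w \<Rightarrow> real"
  assumes grm: "gaussian_random_measure M \<mu> W"
begin

text \<open>The sets \<open>B i\<close> may repeat, whereas the Gaussian family property speaks of
  finite sets of indices; the coefficients of equal sets are collected first.\<close>

lemma centered_gaussian_step:
  assumes "\<And>i. i < m \<Longrightarrow> B i \<in> finite_measure_sets \<mu>"
  shows "centered_gaussian M (\<lambda>\<omega>. \<Sum>i<(m::nat). c i * W (B i) \<omega>)"
proof -
  have "(\<Sum>i<m. c i * W (B i) \<omega>)
    = (\<Sum>C\<in>B ` {..<m}. (\<Sum>i | i \<in> {..<m} \<and> B i = C. c i) * W C \<omega>)" for \<omega>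
    by (subst sum.image_gen[where g = B]) (auto simp: sum_distrib_right intro!: sum.cong)
  then show ?thesis
    using grm assms unfolding gaussian_random_measure_def centered_gaussian_family_def
    by (simp add: image_subset_iff)
qed

lemma W_L2: "B \<in> finite_measure_sets \<mu> \<Longrightarrow> W B \<in> L2_space M"
  using centered_gaussian_L2[OF centered_gaussian_step[of 1 "\<lambda>_. B" "\<lambda>_. 1"]] by simp

lemma W_inner_self: "B \<in> finite_measure_sets \<mu> \<Longrightarrow> L2_inner M (W B) (W B) = measure \<mu> B"
  using grm by (simp add: gaussian_random_measure_def L2_inner_def power2_eq_square)

lemma finite_measure_sets_closed:
  assumes "B \<in> finite_measure_sets \<mu>" "C \<in> finite_measure_sets \<mu>"
  shows "B \<inter> C \<in> finite_measure_sets \<mu>" "B - C \<in> finite_measure_sets \<mu>"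
    "B \<union> C \<in> finite_measure_sets \<mu>"
proof -
  have [measurable]: "B \<in> sets \<mu>" "C \<in> sets \<mu>" and f: "emeasure \<mu> B < \<infinity>" "emeasure \<mu> C < \<infinity>"
    using assms by (auto simp: finite_measure_sets_def)
  have "emeasure \<mu> (B \<inter> C) \<le> emeasure \<mu> B" "emeasure \<mu> (B - C) \<le> emeasure \<mu> B"
    by (auto intro: emeasure_mono)
  moreover have "emeasure \<mu> (B \<union> C) \<le> emeasure \<mu> B + emeasure \<mu> C"
    by (rule emeasure_subadditive) auto
  ultimately show "B \<inter> C \<in> finite_measure_sets \<mu>" "B - C \<in> finite_measure_sets \<mu>"
    "B \<union> C \<in> finite_measure_sets \<mu>"
    using f by (auto simp: finite_measure_sets_def intro: le_less_trans)
qed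

lemma W_union:
  assumes "B \<in> finite_measure_sets \<mu>" "C \<in> finite_measure_sets \<mu>" "B \<inter> C = {}"
  shows "AE \<omega> in M. W (B \<union> C) \<omega> = W B \<omega> + W C \<omega>"
  using grm assms by (simp add: gaussian_random_measure_def)

text \<open>By additivity the second moment of \<open>W B + W C\<close> is the measure of the union,
  which leaves no room for the cross term.\<close>

lemma W_inner_disjoint:
  assumes "B \<in> finite_measure_sets \<mu>" "C \<in> finite_measure_sets \<mu>" "B \<inter> C = {}"
  shows "L2_inner M (W B) (W C) = 0"
proof -
  note L = W_L2[OF assms(1)] W_L2[OF assms(2)] W_L2[OF finite_measure_sets_closed(3)[OF assms(1,2)]]
  note [measurable] = L[THEN L2_space_measurable]
  have "measure \<mu> (B \<union> C) = L2_inner M (W (B \<union> C)) (W (B \<union> C))"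
    using W_inner_self finite_measure_sets_closed(3) assms by simp
  also have "\<dots> = L2_inner M (\<lambda>\<omega>. W B \<omega> + W C \<omega>) (\<lambda>\<omega>. W B \<omega> + W C \<omega>)"
    using W_union[OF assms] by (intro L2_inner_cong_AE) auto
  also have "\<dots> = measure \<mu> B + 2 * L2_inner M (W B) (W C) + measure \<mu> C"
    using L2_inner_add_self[OF L(1,2), of 1] by (simp add: W_inner_self assms)
  also have "measure \<mu> (B \<union> C) = measure \<mu> B + measure \<mu> C"
    using assms by (intro measure_Union) (auto simp: finite_measure_sets_def)
  finally show ?thesis by simp
qed

lemma W_inner_split:
  assumes "B \<in> finite_measure_sets \<mu>" "C \<in> finite_measure_sets \<mu>" "D \<in> finite_measure_sets \<mu>"
  shows "L2_inner M (W B) (W D) = L2_inner M (W (B \<inter> C)) (W D) + L2_inner M (W (B - C)) (W D)"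
proof -
  note F = finite_measure_sets_closed(1,2)[OF assms(1,2)]
  note L = W_L2[OF F(1)] W_L2[OF F(2)] W_L2[OF assms(1)] W_L2[OF assms(3)]
  note [measurable] = L[THEN L2_space_measurable]
  have "AE \<omega> in M. W B \<omega> = W (B \<inter> C) \<omega> + W (B - C) \<omega>"
    using W_union[OF F] by (simp add: Un_Diff_Int Int_Diff_disjoint inf_sup_aci)
  then have "L2_inner M (W B) (W D) = L2_inner M (\<lambda>\<omega>. W (B \<inter> C) \<omega> + W (B - C) \<omega>) (W D)"
    by (intro L2_inner_cong_AE) auto
  also have "\<dots> = L2_inner M (W (B \<inter> C)) (W D) + L2_inner M (W (B - C)) (W D)"
    using L2_space_integrable_mult[OF L(1,4)] L2_space_integrable_mult[OF L(2,4)]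
    by (simp add: L2_inner_def distrib_right)
  finally show ?thesis .
qed

text \<open>Both sets are cut along their intersection. The disjoint pieces drop out, and the second
  moment of \<open>W (B \<inter> C)\<close> remains.\<close>

lemma W_inner:
  assumes "B \<in> finite_measure_sets \<mu>" "C \<in> finite_measure_sets \<mu>"
  shows "L2_inner M (W B) (W C) = measure \<mu> (B \<inter> C)"
proof -
  note F = finite_measure_sets_closed(1,2)[OF assms] finite_measure_sets_closed(2)[OF assms(2,1)]
  have "L2_inner M (W B) (W C) = L2_inner M (W (B \<inter> C)) (W C)"
    using W_inner_split[OF assms assms(2)] W_inner_disjoint[OF F(2) assms(2)] by auto
  also have "\<dots> = L2_inner M (W C) (W (B \<inter> C))" by (rule L2_inner_commute)
  also have "\<dots> = L2_inner M (W (C \<inter> B)) (W (B \<inter> C)) + L2_inner M (W (C - B)) (W (B \<inter> C))"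
    by (rule W_inner_split) (use assms F in auto)
  also have "L2_inner M (W (C - B)) (W (B \<inter> C)) = 0"
    by (rule W_inner_disjoint) (use F in auto)
  finally show ?thesis using W_inner_self[OF F(1)] by (simp add: Int_commute)
qed

text \<open>The variables \<open>W (B i)\<close> and the indicators of the \<open>B i\<close> have
  the same Gram matrix.\<close>

lemma step_isometry:
  assumes "\<And>i. i < m \<Longrightarrow> B i \<in> finite_measure_sets \<mu>"
  shows "L2_norm M (\<lambda>\<omega>. \<Sum>i<(m::nat). c i * W (B i) \<omega>)
    = L2_norm \<mu> (\<lambda>z. \<Sum>i<m. c i * indicator (B i) z)"
proof -
  have ind: "indicator (B i) \<in> L2_space \<mu>" if "i < m" for i
    using assms[OF that] by (intro L2_space_indicator) (auto simp: finite_measure_sets_def)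
  have "L2_inner \<mu> (indicator (B i)) (indicator (B j)) = measure \<mu> (B i \<inter> B j)" if "i < m" "j < m" for i j
    unfolding L2_inner_def indicator_inter_arith[symmetric]
    using finite_measure_sets_closed(1)[OF assms[OF that(1)] assms[OF that(2)]]
    by (auto simp: finite_measure_sets_def Int_absorb2 dest: sets.sets_into_space)
  then show ?thesis
    unfolding L2_norm_def
    by (subst (1 2) L2_inner_sum_sum) (auto simp: W_L2 assms ind W_inner intro!: arg_cong[where f=sqrt] sum.cong)
qed

text \<open>Both facts pass from step functions to the limit, because one and the same sequence of
  steps approximates \<open>g\<close> and, through \<open>W\<close>, also \<open>X\<close>.\<close>

lemma has_noise_integral_isometry:
  assumes "has_noise_integral M \<mu> W g X"
  shows "L2_norm M X = L2_norm \<mu> g"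
    and "centered_gaussian M X"
proof -
  obtain m c B where B: "\<And>k i. i < (m k :: nat) \<Longrightarrow> B k i \<in> finite_measure_sets \<mu>"
    and lg: "(\<lambda>k. L2_norm \<mu> (\<lambda>z. (\<Sum>i<m k. c k i * indicator (B k i) z) - g z)) \<longlonglongrightarrow> 0"
    and lX: "(\<lambda>k. L2_norm M (\<lambda>\<omega>. (\<Sum>i<m k. c k i * W (B k i) \<omega>) - X \<omega>)) \<longlonglongrightarrow> 0"
    and g: "g \<in> L2_space \<mu>" and X: "X \<in> L2_space M"
    by (rule has_noise_integralE[OF assms], rule that)
  have 1: "(\<lambda>\<omega>. \<Sum>i<m k. c k i * W (B k i) \<omega>) \<in> L2_space M" for k
    by (intro L2_space_sum L2_space_scale W_L2) (use B in auto)
  have 2: "(\<lambda>z. \<Sum>i<m k. c k i * indicator (B k i) z) \<in> L2_space \<mu>" for k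
    by (intro L2_space_sum L2_space_scale L2_space_indicator)
      (use B in \<open>auto simp: finite_measure_sets_def\<close>)
  have "(\<lambda>k. L2_norm M (\<lambda>\<omega>. \<Sum>i<m k. c k i * W (B k i) \<omega>)) \<longlonglongrightarrow> L2_norm M X"
    by (rule L2_norm_tendsto[OF 1 X lX])
  moreover have "(\<lambda>k. L2_norm M (\<lambda>\<omega>. \<Sum>i<m k. c k i * W (B k i) \<omega>)) \<longlonglongrightarrow> L2_norm \<mu> g"
    using L2_norm_tendsto[OF 2 g lg] by (simp add: step_isometry B)
  ultimately show "L2_norm M X = L2_norm \<mu> g" by (rule LIMSEQ_unique)
  show "centered_gaussian M X"
    by (rule centered_gaussian_L2_limit[OF centered_gaussian_step X lX]) (use B in auto)
qed

lemma has_noise_integral_scale: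
  assumes "has_noise_integral M \<mu> W g X"
  shows "has_noise_integral M \<mu> W (\<lambda>z. a * g z) (\<lambda>\<omega>. a * X \<omega>)"
proof -
  obtain m c B where B: "\<And>k i. i < (m k :: nat) \<Longrightarrow> B k i \<in> finite_measure_sets \<mu>"
    and lg: "(\<lambda>k. L2_norm \<mu> (\<lambda>z. (\<Sum>i<m k. c k i * indicator (B k i) z) - g z)) \<longlonglongrightarrow> 0"
    and lX: "(\<lambda>k. L2_norm M (\<lambda>\<omega>. (\<Sum>i<m k. c k i * W (B k i) \<omega>) - X \<omega>)) \<longlonglongrightarrow> 0"
    and g: "g \<in> L2_space \<mu>" and X: "X \<in> L2_space M"
    by (rule has_noise_integralE[OF assms], rule that)
  have eq: "(\<Sum>i<n. a * d i * h i) - a * y = a * ((\<Sum>i<n. d i * h i) - y)"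
    for n y and d h :: "nat \<Rightarrow> real"
    by (simp add: sum_distrib_left mult.assoc right_diff_distrib)
  have "(\<lambda>k. L2_norm \<mu> (\<lambda>z. (\<Sum>i<m k. a * c k i * indicator (B k i) z) - a * g z)) \<longlonglongrightarrow> 0"
    unfolding eq L2_norm_scale using tendsto_mult_left[OF lg, of "\<bar>a\<bar>"] by simp
  moreover have "(\<lambda>k. L2_norm M (\<lambda>\<omega>. (\<Sum>i<m k. a * c k i * W (B k i) \<omega>) - a * X \<omega>)) \<longlonglongrightarrow> 0"
    unfolding eq L2_norm_scale using tendsto_mult_left[OF lX, of "\<bar>a\<bar>"] by simp
  ultimately show ?thesis
    unfolding has_noise_integral_def using B g X
    by (intro conjI L2_space_scale exI[of _ m] exI[of _ "\<lambda>k i. a * c k i"] exI[of _ B]) auto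
qed

lemma has_noise_integral_add:
  assumes "has_noise_integral M \<mu> W g X" "has_noise_integral M \<mu> W h Y"
  shows "has_noise_integral M \<mu> W (\<lambda>z. g z + h z) (\<lambda>\<omega>. X \<omega> + Y \<omega>)"
proof -
  obtain m c B where B: "\<And>k i. i < (m k :: nat) \<Longrightarrow> B k i \<in> finite_measure_sets \<mu>"
    and lg: "(\<lambda>k. L2_norm \<mu> (\<lambda>z. (\<Sum>i<m k. c k i * indicator (B k i) z) - g z)) \<longlonglongrightarrow> 0"
    and lX: "(\<lambda>k. L2_norm M (\<lambda>\<omega>. (\<Sum>i<m k. c k i * W (B k i) \<omega>) - X \<omega>)) \<longlonglongrightarrow> 0"
    and g: "g \<in> L2_space \<mu>" and X: "X \<in> L2_space M"
    by (rule has_noise_integralE[OF assms(1)], rule that)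
  obtain n d C where C: "\<And>k i. i < (n k :: nat) \<Longrightarrow> C k i \<in> finite_measure_sets \<mu>"
    and lh: "(\<lambda>k. L2_norm \<mu> (\<lambda>z. (\<Sum>i<n k. d k i * indicator (C k i) z) - h z)) \<longlonglongrightarrow> 0"
    and lY: "(\<lambda>k. L2_norm M (\<lambda>\<omega>. (\<Sum>i<n k. d k i * W (C k i) \<omega>) - Y \<omega>)) \<longlonglongrightarrow> 0"
    and h: "h \<in> L2_space \<mu>" and Y: "Y \<in> L2_space M"
    by (rule has_noise_integralE[OF assms(2)], rule that)
  \<comment> \<open>The approximants are concatenated: a block for \<open>g\<close> of length
    \<open>m k\<close>, followed by a block for \<open>h\<close> whose index restarts at
    \<open>i - m k\<close>.\<close>
  define e where "e k i = (if i < m k then c k i else d k (i - m k))" for k i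
  define D where "D k i = (if i < m k then B k i else C k (i - m k))" for k i
  have eq: "(\<Sum>i<m k + n k. e k i * F (D k i)) - (y + z)
      = ((\<Sum>i<m k. c k i * F (B k i)) - y) + ((\<Sum>i<n k. d k i * F (C k i)) - z)" for F :: "'s set \<Rightarrow> real" and y z k
  proof -
    have "(\<Sum>i<m k + n k. e k i * F (D k i)) = (\<Sum>i<m k + n k.
      if i < m k then c k i * F (B k i) else d k (i - m k) * F (C k (i - m k)))"
      by (intro sum.cong) (auto simp: e_def D_def)
    also have "\<dots> = (\<Sum>i<m k. c k i * F (B k i)) + (\<Sum>i<n k. d k i * F (C k i))"
      by (rule sum_lessThan_append)
    finally show ?thesis by simp
  qed
  have L: "(\<lambda>\<omega>. \<Sum>i<m k. c k i * W (B k i) \<omega>) \<in> L2_space M"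
    "(\<lambda>\<omega>. \<Sum>i<n k. d k i * W (C k i) \<omega>) \<in> L2_space M"
    "(\<lambda>z. \<Sum>i<m k. c k i * indicator (B k i) z) \<in> L2_space \<mu>"
    "(\<lambda>z. \<Sum>i<n k. d k i * indicator (C k i) z) \<in> L2_space \<mu>" for k
    by (intro L2_space_sum L2_space_scale W_L2 L2_space_indicator;
      use B C in \<open>auto simp: finite_measure_sets_def\<close>)+
  have "(\<lambda>k. L2_norm \<mu> (\<lambda>z. (\<Sum>i<m k + n k. e k i * indicator (D k i) z) - (g z + h z))) \<longlonglongrightarrow> 0"
    unfolding eq[of _ "\<lambda>B. indicator B z" for z]
    by (rule tendsto_sandwich[OF _ _ tendsto_const tendsto_add_zero[OF lg lh]])
      (intro always_eventually allI L2_norm_nonneg L2_norm_triangle L2_space_diff L g h)+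
  moreover have "(\<lambda>k. L2_norm M (\<lambda>\<omega>. (\<Sum>i<m k + n k. e k i * W (D k i) \<omega>) - (X \<omega> + Y \<omega>))) \<longlonglongrightarrow> 0"
    unfolding eq[of _ "\<lambda>B. W B \<omega>" for \<omega>]
    by (rule tendsto_sandwich[OF _ _ tendsto_const tendsto_add_zero[OF lX lY]])
      (intro always_eventually allI L2_norm_nonneg L2_norm_triangle L2_space_diff L X Y)+
  moreover have "D k i \<in> finite_measure_sets \<mu>" if "i < m k + n k" for k i
    using that B C by (auto simp: D_def)
  ultimately show ?thesis
    unfolding has_noise_integral_def using g X h Y
    by (intro conjI L2_space_add exI[of _ "\<lambda>k. m k + n k"] exI[of _ e] exI[of _ D]) auto
qed

lemma has_noise_integral_sum:
  assumes "finite I" "\<And>i. i \<in> I \<Longrightarrow> has_noise_integral M \<mu> W (g i) (X i)"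
  shows "has_noise_integral M \<mu> W (\<lambda>z. \<Sum>i\<in>I. c i * g i z) (\<lambda>\<omega>. \<Sum>i\<in>I. c i * X i \<omega>)"
  using assms
  by (induction I rule: finite_induct)
    (simp_all add: has_noise_integral_zero has_noise_integral_add has_noise_integral_scale)

end

section \<open>The covariance of the solution of the heat equation\<close>

text \<open>This is sqrt pi / 2 times the error function; the oriented interval integral also
  provides the values at negative arguments.\<close>

definition gauss_int :: "real \<Rightarrow> real" where
  "gauss_int y = (LBINT w=0..ereal y. exp (- w\<^sup>2))"

lemma gauss_int_deriv: "(gauss_int has_real_derivative exp (- y\<^sup>2)) (at y)"
proof -
  \<comment> \<open>The interval contains the base point 0 and has \<open>y\<close> in its interior,
    so the derivative relative to it is the full derivative.\<close>
  let ?a = "- \<bar>y\<bar> - 1" and ?b = "\<bar>y\<bar> + 1"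
  have "((\<lambda>u. LBINT w=ereal 0..ereal u. exp (- w\<^sup>2)) has_vector_derivative exp (- y\<^sup>2)) (at y within {?a..?b})"
    by (rule interval_integral_FTC2) (auto intro!: continuous_intros)
  moreover have "at y within {?a..?b} = at y" by (rule at_within_Icc_at) auto
  ultimately show ?thesis
    by (simp add: gauss_int_def[abs_def] has_real_derivative_iff_has_vector_derivative zero_ereal_def)
qed

lemma gauss_int_0: "gauss_int 0 = 0"
  by (simp add: gauss_int_def zero_ereal_def[symmetric])

lemma gauss_int_minus: "gauss_int (- y) = - gauss_int y"
proof -
  have "((\<lambda>y. gauss_int y + gauss_int (- y)) has_real_derivative 0) (at x)" for x
  proof -
    have "((\<lambda>y. gauss_int (- y)) has_real_derivative exp (- (- x)\<^sup>2) * - 1) (at x)"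
      by (rule DERIV_chain2[OF gauss_int_deriv]) (auto intro!: derivative_eq_intros)
    from DERIV_add[OF gauss_int_deriv this] show ?thesis by simp
  qed
  then have "gauss_int y + gauss_int (- y) = gauss_int 0 + gauss_int (- 0)"
    by (intro DERIV_isconst_all) auto
  then show ?thesis by (simp add: gauss_int_0)
qed

text \<open>Half of the Gaussian integral. For nonzero \<open>z\<close> this limit makes the time
  antiderivative of the kernel vanish at time 0.\<close>

lemma gauss_int_at_top: "(gauss_int \<longlongrightarrow> sqrt pi / 2) at_top"
proof -
  let ?f = "\<lambda>x::real. indicator {0..} x *\<^sub>R exp (- x\<^sup>2)"
  have "((\<lambda>y. \<integral>x. indicator {..y} x *\<^sub>R ?f x \<partial>lborel) \<longlongrightarrow> (\<integral>x. ?f x \<partial>lborel)) at_top"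
    by (rule tendsto_integral_at_top) (use gaussian_moment_0 in \<open>auto simp: has_bochner_integral_iff\<close>)
  also have "(\<integral>x. ?f x \<partial>lborel) = sqrt pi / 2"
    using gaussian_moment_0 by (simp add: has_bochner_integral_iff)
  finally show ?thesis
  proof (rule Lim_transform_eventually)
    show "\<forall>\<^sub>F y in at_top. (\<integral>x. indicator {..y} x *\<^sub>R ?f x \<partial>lborel) = gauss_int y"
      using eventually_ge_at_top[of 0]
    proof eventually_elim
      fix y :: real assume y: "0 \<le> y"
      have "(\<integral>x. indicator {..y} x *\<^sub>R ?f x \<partial>lborel) = (\<integral>x. exp (- x\<^sup>2) * indicator {0..y} x \<partial>lborel)"
        by (intro Bochner_Integration.integral_cong) (auto simp: indicator_def)
      also have "\<dots> = gauss_int y - gauss_int 0"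
        by (rule integral_FTC_Icc_real[OF y]) (auto intro!: gauss_int_deriv continuous_intros)
      finally show "(\<integral>x. indicator {..y} x *\<^sub>R ?f x \<partial>lborel) = gauss_int y"
        by (simp add: gauss_int_0)
    qed
  qed
qed

text \<open>\<open>heat_potential z - \<bar>z\<bar> / 2\<close> is \<open>\<integral>\<^sub>0\<^sup>1 p\<^sub>2\<^sub>t(z) dt\<close>: the potential is its smooth part, with second
  derivative \<open>p\<^sub>2\<close>.\<close>

definition heat_potential :: "real \<Rightarrow> real" where
  "heat_potential z = (exp (- z\<^sup>2 / 4) + z * gauss_int (z / 2)) / sqrt pi"

lemma gauss_int_half_deriv:
  "((\<lambda>z. gauss_int (z / 2) / sqrt pi) has_real_derivative heat_kernel 2 z) (at z)"
proof -
  have "((\<lambda>z. gauss_int (z / 2)) has_real_derivative exp (- (z / 2)\<^sup>2) * (1 / 2)) (at z)"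
    by (rule DERIV_chain2[OF gauss_int_deriv]) (auto intro!: derivative_eq_intros)
  from DERIV_cdivide[OF this, of "sqrt pi"] show ?thesis
    by (simp add: heat_kernel_def power_divide real_sqrt_mult)
qed

text \<open>The derivative of the exponential cancels against the term that comes from
  differentiating \<open>gauss_int (z / 2)\<close>. Only the error function survives, and its
  derivative is the kernel again.\<close>

lemma heat_potential_deriv:
  "(heat_potential has_real_derivative gauss_int (z / 2) / sqrt pi) (at z)"
proof -
  have "((\<lambda>z. gauss_int (z / 2)) has_real_derivative exp (- (z / 2)\<^sup>2) * (1 / 2)) (at z)"
    by (rule DERIV_chain2[OF gauss_int_deriv]) (auto intro!: derivative_eq_intros)
  then have "(heat_potential has_real_derivative (exp (- z\<^sup>2 / 4) * (- (2 * z) / 4)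
      + (1 * gauss_int (z / 2) + exp (- (z / 2)\<^sup>2) * (1 / 2) * z)) / sqrt pi) (at z)"
    unfolding heat_potential_def[abs_def]
    by (intro DERIV_cdivide DERIV_add DERIV_mult) (auto intro!: derivative_eq_intros)
  then show ?thesis by (simp add: power_divide)
qed

lemma heat_kernel_bounds: "t \<ge> 0 \<Longrightarrow> 0 \<le> heat_kernel t u" "t > 0 \<Longrightarrow> heat_kernel t u \<le> 1 / sqrt (2 * pi * t)"
proof -
  show "t \<ge> 0 \<Longrightarrow> 0 \<le> heat_kernel t u" by (simp add: heat_kernel_def)
  assume "t > 0"
  then have "exp (- u\<^sup>2 / (2 * t)) \<le> 1" by simp
  with \<open>t > 0\<close> show "heat_kernel t u \<le> 1 / sqrt (2 * pi * t)"
    unfolding heat_kernel_def by (intro mult_left_le) auto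
qed

text \<open>An explicit antiderivative in time is used. Its end values are taken as one-sided
  limits, since at z = 0 the kernel grows like 1 / sqrt t near time 0.\<close>

lemma set_integral_heat_kernel_time:
  "set_integrable lborel {0<..<1} (\<lambda>t. heat_kernel (2 * t) z)"
  "(LBINT t:{0<..<1}. heat_kernel (2 * t) z) = heat_potential z - \<bar>z\<bar> / 2"
proof -
  \<comment> \<open>By scaling, the integral of the kernel up to time \<open>t\<close> is sqrt t
    times the integral up to time 1 taken at z / sqrt t. \<open>H t\<close> is that expression,
    written with \<bar>z\<bar> so that for small \<open>t\<close> the error function is evaluated
    near plus infinity.\<close>
  define H where "H t = (sqrt t * exp (- z\<^sup>2 / (4 * t)) - \<bar>z\<bar> * (sqrt pi / 2 - gauss_int (\<bar>z\<bar> / (2 * sqrt t)))) / sqrt pi"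
    for t
  have deriv: "(H has_real_derivative heat_kernel (2 * t) z) (at t)" if t: "0 < t" for t
  proof -
    \<comment> \<open>In terms of \<open>r\<close> all derivatives are rational apart from the
      exponential. The two contributions z^2 / (4 r^3) cancel and 1 / (2 r) remains.\<close>
    define r where "r = sqrt t"
    have r: "r > 0" "t = r\<^sup>2" "sqrt t = r" using t by (auto simp: r_def)
    have 1: "(sqrt has_real_derivative 1 / (2 * r)) (at t)"
      using DERIV_real_sqrt[OF t] by (simp add: r(3) field_simps)
    have 2: "((\<lambda>t. \<bar>z\<bar> / (2 * sqrt t)) has_real_derivative - \<bar>z\<bar> / (4 * r ^ 3)) (at t)"
      by (rule derivative_eq_intros 1 refl | use r in \<open>simp add: field_simps power2_eq_square power3_eq_cube\<close>)+
    have 3: "((\<lambda>t. gauss_int (\<bar>z\<bar> / (2 * sqrt t))) has_real_derivative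
      exp (- (\<bar>z\<bar> / (2 * sqrt t))\<^sup>2) * (- \<bar>z\<bar> / (4 * r ^ 3))) (at t)"
      by (rule DERIV_chain2[OF gauss_int_deriv 2])
    have 4: "((\<lambda>t. exp (- z\<^sup>2 / (4 * t))) has_real_derivative
      exp (- z\<^sup>2 / (4 * t)) * (z\<^sup>2 / (4 * r ^ 4))) (at t)"
      using t by (auto intro!: derivative_eq_intros simp: r(2) power2_eq_square power4_eq_xxxx)
    have e: "(\<bar>z\<bar> / (2 * sqrt t))\<^sup>2 = z\<^sup>2 / (4 * t)"
      using t by (simp add: power_divide power_mult_distrib)
    have zz: "\<bar>z\<bar> * (\<bar>z\<bar> * y) = z * (z * y)" for y
      by (simp add: mult.assoc[symmetric])
    have "(H has_real_derivative ((1 / (2 * r)) * exp (- z\<^sup>2 / (4 * t))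
        + (exp (- z\<^sup>2 / (4 * t)) * (z\<^sup>2 / (4 * r ^ 4))) * sqrt t
        - \<bar>z\<bar> * (0 - exp (- (\<bar>z\<bar> / (2 * sqrt t))\<^sup>2) * (- \<bar>z\<bar> / (4 * r ^ 3)))) / sqrt pi) (at t)"
      unfolding H_def[abs_def]
      by (intro DERIV_cdivide DERIV_diff DERIV_mult DERIV_cmult 1 3 4 DERIV_const)
    also have "((1 / (2 * r)) * exp (- z\<^sup>2 / (4 * t))
        + (exp (- z\<^sup>2 / (4 * t)) * (z\<^sup>2 / (4 * r ^ 4))) * sqrt t
        - \<bar>z\<bar> * (0 - exp (- (\<bar>z\<bar> / (2 * sqrt t))\<^sup>2) * (- \<bar>z\<bar> / (4 * r ^ 3)))) / sqrt pi
      = exp (- z\<^sup>2 / (4 * t)) / (2 * r * sqrt pi)"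
      unfolding e r(3) unfolding r(2) using r(1)
      by (simp add: field_simps power2_eq_square power3_eq_cube power4_eq_xxxx zz)
    also have "\<dots> = heat_kernel (2 * t) z"
      using t by (simp add: heat_kernel_def real_sqrt_mult r(3))
    finally show ?thesis .
  qed
  have lim0: "(H \<longlongrightarrow> 0) (at_right 0)"
  proof -
    have s: "(sqrt \<longlongrightarrow> 0) (at_right 0)"
      using tendsto_real_sqrt[OF tendsto_ident_at, of 0 "{0<..}"] by simp
    have "((\<lambda>t. sqrt t * exp (- z\<^sup>2 / (4 * t))) \<longlongrightarrow> 0) (at_right 0)"
    proof (rule Lim_null_comparison[OF _ s])
      show "\<forall>\<^sub>F t in at_right 0. norm (sqrt t * exp (- z\<^sup>2 / (4 * t))) \<le> sqrt t"
        unfolding eventually_at_right_field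
        by (intro exI[of _ 1]) (auto simp: abs_mult intro!: mult_left_le)
    qed
    moreover have "((\<lambda>t. \<bar>z\<bar> * (sqrt pi / 2 - gauss_int (\<bar>z\<bar> / (2 * sqrt t)))) \<longlongrightarrow> 0) (at_right 0)"
    \<comment> \<open>At z = 0 the argument of the error function does not grow, but there the
      factor \<bar>z\<bar> is 0.\<close>
    proof (cases "z = 0")
      case False
      have "filterlim (\<lambda>t. \<bar>z\<bar> / (2 * sqrt t)) at_top (at_right 0)"
        using False by real_asymp
      from tendsto_mult_left[OF tendsto_diff[OF tendsto_const filterlim_compose[OF gauss_int_at_top this]],
          of "\<bar>z\<bar>" "sqrt pi / 2"]
      show ?thesis by simp
    qed simp
    ultimately have "(H \<longlongrightarrow> (0 - 0) / sqrt pi) (at_right 0)"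
      unfolding H_def[abs_def] by (intro tendsto_intros) auto
    then show ?thesis by simp
  qed
  have lim1: "(H \<longlongrightarrow> H 1) (at_left 1)"
    using DERIV_isCont[OF deriv[of 1]] by (simp add: isCont_def filterlim_at_split)
  have cont: "isCont (\<lambda>t. heat_kernel (2 * t) z) t" if "0 < t" for t
    unfolding heat_kernel_def using that by (intro continuous_intros) auto
  have ein: "einterval (ereal 0) (ereal 1) = {0<..<1}" by (simp add: einterval_eq)
  note FTC = interval_integral_FTC_nonneg[of "ereal 0" "ereal 1" H "\<lambda>t. heat_kernel (2 * t) z" 0 "H 1"]
  \<comment> \<open>Oddness of the error function makes \<bar>z\<bar> \<open>gauss_int\<close>
    (\<bar>z\<bar> / 2) equal to z \<open>gauss_int\<close> (z / 2).\<close>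
  have H1: "H 1 = heat_potential z - \<bar>z\<bar> / 2"
    using gauss_int_minus[of "z / 2"]
    by (auto simp: H_def heat_potential_def abs_if field_simps)
  show "set_integrable lborel {0<..<1} (\<lambda>t. heat_kernel (2 * t) z)"
    unfolding ein[symmetric]
    by (rule FTC(1)) (use lim0 lim1 in \<open>auto intro!: deriv cont heat_kernel_bounds
      simp: ereal_tendsto_simps1\<close>)
  have "(LBINT t=ereal 0..ereal 1. heat_kernel (2 * t) z) = H 1 - 0"
    by (rule FTC(2)) (use lim0 lim1 in \<open>auto intro!: deriv cont heat_kernel_bounds
      simp: ereal_tendsto_simps1\<close>)
  then show "(LBINT t:{0<..<1}. heat_kernel (2 * t) z) = heat_potential z - \<bar>z\<bar> / 2"
    using H1 by (simp add: interval_lebesgue_integral_def ein)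
qed

lemma nn_integral_heat_kernel_time:
  "(\<integral>\<^sup>+s. ennreal (heat_kernel (2 * (1 - s)) z) * indicator {0<..<1} s \<partial>lborel)
    = ennreal (heat_potential z - \<bar>z\<bar> / 2)"
proof -
  have "(\<integral>\<^sup>+s. ennreal (heat_kernel (2 * (1 - s)) z) * indicator {0<..<1} s \<partial>lborel)
    = ennreal \<bar>-1\<bar> * (\<integral>\<^sup>+s. ennreal (heat_kernel (2 * (1 - (1 + (-1) * s))) z) * indicator {0<..<1} (1 + (-1) * s) \<partial>lborel)"
    by (rule nn_integral_real_affine) (auto simp: heat_kernel_def)
  also have "\<dots> = (\<integral>\<^sup>+s. ennreal (indicator {0<..<1} s * heat_kernel (2 * s) z) \<partial>lborel)"
    by (auto simp: indicator_def intro!: nn_integral_cong)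
  also have "\<dots> = ennreal (\<integral>s. indicator {0<..<1} s * heat_kernel (2 * s) z \<partial>lborel)"
    using set_integral_heat_kernel_time(1)[of z]
    by (intro nn_integral_eq_integral) (auto simp: set_integrable_def indicator_def heat_kernel_bounds)
  finally show ?thesis
    using set_integral_heat_kernel_time(2)[of z] by (simp add: set_lebesgue_integral_def)
qed

text \<open>The semigroup law: the sum of two independent centered normal variables of variance
  \<open>t\<close> has variance \<open>2 * t\<close>. The shift v = w + y brings the integral into
  convolution form.\<close>

lemma heat_kernel_convolution:
  assumes "t > 0"
  shows "(\<integral>\<^sup>+v. ennreal (heat_kernel t (u - v) * heat_kernel t (w - v)) \<partial>lborel)
    = ennreal (heat_kernel (2 * t) (u - w))"
proof -
  have n: "heat_kernel r y = normal_density 0 (sqrt r) y" if "r > 0" for r y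
    using that by (simp add: heat_kernel_def normal_density_def)
  have "(\<integral>\<^sup>+v. ennreal (heat_kernel t (u - v) * heat_kernel t (w - v)) \<partial>lborel)
    = ennreal \<bar>1\<bar> * (\<integral>\<^sup>+y. ennreal (heat_kernel t (u - (w + 1 * y)) * heat_kernel t (w - (w + 1 * y))) \<partial>lborel)"
    by (rule nn_integral_real_affine) (auto simp: heat_kernel_def)
  also have "\<dots> = (\<integral>\<^sup>+y. ennreal (normal_density 0 (sqrt t) ((u - w) - y) * normal_density 0 (sqrt t) y) \<partial>lborel)"
    using assms by (simp add: n algebra_simps normal_density_def)
  also have "\<dots> = ennreal (normal_density 0 (sqrt ((sqrt t)\<^sup>2 + (sqrt t)\<^sup>2)) (u - w))"
    by (subst conv_normal_density_zero_mean[THEN fun_cong]) (use assms in auto)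
  also have "\<dots> = ennreal (heat_kernel (2 * t) (u - w))"
    using assms by (simp add: n)
  finally show ?thesis .
qed

text \<open>The integrand is nonnegative, so by Tonelli the space integral, where the semigroup law
  applies, can be done before the time integral; finiteness comes out of the computation.\<close>

lemma heat_kernel_inner:
  "L2_inner (restrict_space lborel (UNIV \<times> {0..1})) (\<lambda>(v, s). heat_kernel (1 - s) (u - v))
     (\<lambda>(v, s). heat_kernel (1 - s) (w - v)) = heat_potential (u - w) - \<bar>u - w\<bar> / 2"
    (is "L2_inner ?\<mu> ?g ?h = ?r")
proof -
  have S: "UNIV \<times> {0..1::real} \<in> sets (borel :: (real \<times> real) measure)"
    by (intro borel_closed closed_Times) auto
  let ?k = "\<lambda>z::real \<times> real. indicator (UNIV \<times> {0..1}) z * (?g z * ?h z)"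
  have m1: "(\<lambda>(v, s). heat_kernel (1 - s) (a - v)) \<in> borel_measurable (borel :: (real \<times> real) measure)" for a
    unfolding heat_kernel_def borel_prod[symmetric] by measurable
  have mk: "?k \<in> borel_measurable borel"
    using m1[of u] m1[of w] S by (intro borel_measurable_times borel_measurable_indicator) auto
  have nonneg: "0 \<le> ?k z" for z
    by (auto simp: indicator_def heat_kernel_bounds split: prod.split)
  have "L2_inner ?\<mu> ?g ?h = (\<integral>z. ?k z \<partial>lborel)"
    unfolding L2_inner_def using S by (subst integral_restrict_space) auto
  also have "\<dots> = enn2real (\<integral>\<^sup>+z. ennreal (?k z) \<partial>lborel)"
    by (rule integral_eq_nn_integral) (use mk nonneg in auto)
  also have "(\<integral>\<^sup>+z. ennreal (?k z) \<partial>lborel) = (\<integral>\<^sup>+s. \<integral>\<^sup>+v. ennreal (?k (v, s)) \<partial>lborel \<partial>lborel)"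
    unfolding lborel_prod[symmetric]
    by (rule lborel_pair.nn_integral_snd[symmetric])
       (use mk in \<open>simp add: lborel_prod split_beta\<close>)
  also have "\<dots> = (\<integral>\<^sup>+s. ennreal (heat_kernel (2 * (1 - s)) (u - w)) * indicator {0<..<1} s \<partial>lborel)"
  proof (rule nn_integral_cong_AE)
    show "AE s in lborel. (\<integral>\<^sup>+v. ennreal (?k (v, s)) \<partial>lborel)
      = ennreal (heat_kernel (2 * (1 - s)) (u - w)) * indicator {0<..<1} s"
      \<comment> \<open>The end times form a null set. Without them the kernel time
        \<open>1 - s\<close> is positive on the strip, and the open interval of the time integral is
        matched.\<close>
      using AE_lborel_singleton[of 0] AE_lborel_singleton[of 1]
    proof eventually_elim
      fix s :: real assume "s \<noteq> 0" "s \<noteq> 1"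
      then show "(\<integral>\<^sup>+v. ennreal (?k (v, s)) \<partial>lborel)
        = ennreal (heat_kernel (2 * (1 - s)) (u - w)) * indicator {0<..<1} s"
        using heat_kernel_convolution[of "1 - s" u w]
        by (cases "0 < s \<and> s < 1") (auto simp: indicator_def)
    qed
  qed
  also have "\<dots> = ennreal ?r" by (rule nn_integral_heat_kernel_time)
  \<comment> \<open>\<open>ennreal\<close> sends negative reals to 0, so the value can be read back
    only when it is nonnegative, which it is as the integral of a kernel.\<close>
  also have "enn2real (ennreal ?r) = ?r"
  proof (rule enn2real_ennreal)
    show "0 \<le> ?r"
      unfolding set_integral_heat_kernel_time(2)[symmetric] set_lebesgue_integral_def
      by (intro Bochner_Integration.integral_nonneg) (auto simp: indicator_def heat_kernel_bounds)
  qed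
  finally show ?thesis .
qed

section \<open>Increments against step functions\<close>

lemma integral_interval_lborel:
  fixes f :: "real \<Rightarrow> real"
  shows "(\<integral>x. f x \<partial>interval_lborel a b) = (\<integral>x. indicator {a..b} x * f x \<partial>lborel)"
  by (subst integral_restrict_space) auto

lemma finite_measure_interval_lborel: "finite_measure (interval_lborel a b)"
  by (intro finite_measureI) (simp add: emeasure_restrict_space space_restrict_space emeasure_lborel_Icc_eq)

lemma measure_interval_lborel: "a \<le> b \<Longrightarrow> measure (interval_lborel a b) (space (interval_lborel a b)) = b - a"
  by (simp add: measure_restrict_space space_restrict_space)

lemma indicator_interval_L2: "indicator {a..u} \<in> L2_space (interval_lborel a b)"
proof -
  interpret finite_measure "interval_lborel a b" by (rule finite_measure_interval_lborel)
  have [measurable]: "(indicator {a..u} :: real \<Rightarrow> real) \<in> borel_measurable (interval_lborel a b)"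
    by (intro measurable_restrict_space1) auto
  have "AE x in interval_lborel a b. norm ((indicator {a..u} x :: real)\<^sup>2) \<le> 1"
    by (auto simp: indicator_def)
  then have "integrable (interval_lborel a b) (\<lambda>x. (indicator {a..u} x :: real)\<^sup>2)"
    by (rule integrable_const_bound) measurable
  then show ?thesis by (simp add: L2_space_def)
qed

lemma L2_inner_indicator_interval:
  assumes "u \<in> {a..b}" "w \<in> {a..b}"
  shows "L2_inner (interval_lborel a b) (indicator {a..u}) (indicator {a..w}) = min u w - a"
proof -
  have "L2_inner (interval_lborel a b) (indicator {a..u}) (indicator {a..w})
    = (\<integral>x. indicator {a..min u w} x \<partial>lborel)"
    unfolding L2_inner_def integral_interval_lborel
    using assms by (intro Bochner_Integration.integral_cong) (auto simp: indicator_def)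
  then show ?thesis using assms by simp
qed

lemma integral_indicator_FTC:
  fixes F f :: "real \<Rightarrow> real"
  assumes "u \<in> {a..b}" "\<And>x. (F has_real_derivative f x) (at x)" "\<And>x. isCont f x"
  shows "(\<integral>x. indicator {a..u} x * f x \<partial>interval_lborel a b) = F u - F a"
    and "integrable (interval_lborel a b) (\<lambda>x. indicator {a..u} x * f x)"
proof -
  have eq: "indicator {a..b} x * (indicator {a..u} x * f x) = f x * indicator {a..u} x" for x
    using assms(1) by (auto simp: indicator_def)
  show "(\<integral>x. indicator {a..u} x * f x \<partial>interval_lborel a b) = F u - F a"
    unfolding integral_interval_lborel eq
    by (rule integral_FTC_Icc_real) (use assms in auto)
  have "set_integrable lborel {a..u} f"
    by (rule borel_integrable_atLeastAtMost') (use assms continuous_at_imp_continuous_on in blast)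
  moreover have "indicator {a..b} x *\<^sub>R (indicator {a..u} x * f x) = indicator {a..u} x *\<^sub>R f x" for x
    using assms(1) by (auto simp: indicator_def)
  ultimately show "integrable (interval_lborel a b) (\<lambda>x. indicator {a..u} x * f x)"
    by (subst integrable_restrict_space) (simp_all only: set_integrable_def, auto)
qed

text \<open>The parts -\<bar>p - q\<bar> / 2 of the four covariances combine to
  \<open>min u w - a\<close>, the covariance of a Brownian motion started at \<open>a\<close> and
  also the inner product of the indicators of \<open>{a..u}\<close> and \<open>{a..w}\<close>. What
  is left is a mixed second difference of the smooth potential.\<close>

lemma heat_kernel_increment_inner:
  fixes a :: real
  defines "\<mu> \<equiv> restrict_space lborel (UNIV \<times> {0..1})"
  defines "k \<equiv> \<lambda>u (v, s). heat_kernel (1 - s) (u - v)"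
  assumes L: "k u \<in> L2_space \<mu>" "k w \<in> L2_space \<mu>" "k a \<in> L2_space \<mu>" and "a \<le> u" "a \<le> w"
  shows "L2_inner \<mu> (\<lambda>z. k u z - k a z) (\<lambda>z. k w z - k a z) = min u w - a
    - (heat_potential (u - a) - heat_potential (u - w) - heat_potential 0 + heat_potential (a - w))"
proof -
  have i: "L2_inner \<mu> (k p) (k q) = heat_potential (p - q) - \<bar>p - q\<bar> / 2" for p q
    unfolding \<mu>_def k_def by (rule heat_kernel_inner)
  have "L2_inner \<mu> (\<lambda>z. k u z - k a z) (\<lambda>z. k w z - k a z)
    = L2_inner \<mu> (k u) (k w) - L2_inner \<mu> (k u) (k a) - L2_inner \<mu> (k a) (k w) + L2_inner \<mu> (k a) (k a)"
  proof -
    note [simp] = L2_space_integrable_mult[OF L(1,2)] L2_space_integrable_mult[OF L(1,3)]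
      L2_space_integrable_mult[OF L(3,2)] L2_space_integrable_mult[OF L(3,3)]
    have "L2_inner \<mu> (\<lambda>z. k u z - k a z) (\<lambda>z. k w z - k a z)
      = (\<integral>z. k u z * k w z - k u z * k a z - k a z * k w z + k a z * k a z \<partial>\<mu>)"
      unfolding L2_inner_def by (intro Bochner_Integration.integral_cong) (auto simp: algebra_simps)
    then show ?thesis by (simp add: L2_inner_def)
  qed
  note * = this
  show ?thesis
  proof -
    have "\<bar>u - a\<bar> = u - a" "\<bar>a - w\<bar> = w - a" "\<bar>u - w\<bar> = u + w - 2 * min u w" using \<open>a \<le> u\<close> \<open>a \<le> w\<close> by auto
    then show ?thesis unfolding * i by (simp add: field_simps)
  qed
qed

text \<open>The second derivative of the potential is the kernel, so the bracket is the double
  integral of \<open>heat_kernel 2 (x - y)\<close> over \<open>x\<close> in \<open>{a..u i}\<close>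
  and \<open>y\<close> in \<open>{a..u j}\<close>. The sum is therefore the quadratic form of the
  kernel at \<open>f\<close>.\<close>

lemma heat_quadratic_form:
  fixes a b :: real and c u :: "'i \<Rightarrow> real" and I :: "'i set"
  defines "N \<equiv> interval_lborel a b"
  defines "f \<equiv> \<lambda>x. \<Sum>i\<in>I. c i * indicator {a..u i} x"
  assumes "a \<le> b" and I: "finite I" "\<And>i. i \<in> I \<Longrightarrow> u i \<in> {a..b}"
  shows "\<bar>\<Sum>i\<in>I. \<Sum>j\<in>I. c i * c j * (heat_potential (u i - a) - heat_potential (u i - u j)
      - heat_potential 0 + heat_potential (a - u j))\<bar>
    \<le> (b - a) / (2 * sqrt pi) * (L2_norm N f)\<^sup>2"
proof -
  define Q where "Q i j = heat_potential (u i - a) - heat_potential (u i - u j)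
      - heat_potential 0 + heat_potential (a - u j)" for i j
  \<comment> \<open>The kernel operator applied to \<open>f\<close>; the quadratic form becomes the
    integral of \<open>f x * h x\<close>.\<close>
  define h where "h x = (\<integral>y. f y * heat_kernel 2 (x - y) \<partial>N)" for x
  interpret N: finite_measure N unfolding N_def by (rule finite_measure_interval_lborel)
  have fL: "f \<in> L2_space N"
    unfolding f_def N_def by (intro L2_space_sum L2_space_scale indicator_interval_L2)
  have fi: "integrable N f" by (rule integral_abs_le_L2_norm(1)[OF N.finite_measure_axioms fL])
  have contK: "isCont (\<lambda>y. heat_kernel 2 (x - y)) y" for x y
    unfolding heat_kernel_def by (intro continuous_intros) auto
  have derivK: "((\<lambda>y. - (gauss_int ((x - y) / 2) / sqrt pi)) has_real_derivative heat_kernel 2 (x - y)) (at y)" for x y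
  proof -
    have "((\<lambda>y. gauss_int ((x - y) / 2) / sqrt pi) has_real_derivative heat_kernel 2 (x - y) * - 1) (at y)"
      by (rule DERIV_chain2[OF gauss_int_half_deriv]) (auto intro!: derivative_eq_intros)
    from DERIV_minus[OF this] show ?thesis by simp
  qed
  have inner: "(\<integral>y. indicator {a..u j} y * heat_kernel 2 (x - y) \<partial>N)
      = gauss_int ((x - a) / 2) / sqrt pi - gauss_int ((x - u j) / 2) / sqrt pi"
    "integrable N (\<lambda>y. indicator {a..u j} y * heat_kernel 2 (x - y))" if "j \<in> I" for x j
    unfolding N_def using integral_indicator_FTC[OF I(2)[OF that] derivK contK, of x] by simp_all
  have h: "h x = (\<Sum>j\<in>I. c j * (gauss_int ((x - a) / 2) / sqrt pi - gauss_int ((x - u j) / 2) / sqrt pi))" for x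
  proof -
    have "h x = (\<integral>y. (\<Sum>j\<in>I. c j * (indicator {a..u j} y * heat_kernel 2 (x - y))) \<partial>N)"
      by (simp add: h_def f_def sum_distrib_right mult.assoc)
    also have "\<dots> = (\<Sum>j\<in>I. \<integral>y. c j * (indicator {a..u j} y * heat_kernel 2 (x - y)) \<partial>N)"
      by (rule Bochner_Integration.integral_sum) (use inner(2) in auto)
    also have "\<dots> = (\<Sum>j\<in>I. c j * (gauss_int ((x - a) / 2) / sqrt pi - gauss_int ((x - u j) / 2) / sqrt pi))"
      by (intro sum.cong) (auto simp: inner(1))
    finally show ?thesis .
  qed
  have contg: "isCont (\<lambda>x. gauss_int ((x - p) / 2) / sqrt pi) x" for p x
    by (rule DERIV_isCont, rule DERIV_chain2[OF gauss_int_half_deriv]) (auto intro!: derivative_eq_intros)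
  have conth: "isCont h x" for x
    unfolding h[abs_def] by (intro continuous_intros contg)
  have derivP: "((\<lambda>x. heat_potential (x - p)) has_real_derivative gauss_int ((x - p) / 2) / sqrt pi) (at x)" for p x
  proof -
    have "((\<lambda>x. heat_potential (x - p)) has_real_derivative gauss_int ((x - p) / 2) / sqrt pi * 1) (at x)"
      by (rule DERIV_chain2[OF heat_potential_deriv]) (auto intro!: derivative_eq_intros)
    then show ?thesis by simp
  qed
  have derivH: "((\<lambda>x. \<Sum>j\<in>I. c j * (heat_potential (x - a) - heat_potential (x - u j))) has_real_derivative h x) (at x)" for x
    unfolding h by (intro DERIV_sum DERIV_cmult DERIV_diff derivP)
  have outer: "(\<integral>x. indicator {a..u i} x * h x \<partial>N) = (\<Sum>j\<in>I. c j * Q i j)"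
    "integrable N (\<lambda>x. indicator {a..u i} x * h x)" if "i \<in> I" for i
  proof -
    note FTC = integral_indicator_FTC[OF I(2)[OF that] derivH conth, folded N_def]
    show "integrable N (\<lambda>x. indicator {a..u i} x * h x)" by (rule FTC(2))
    show "(\<integral>x. indicator {a..u i} x * h x \<partial>N) = (\<Sum>j\<in>I. c j * Q i j)"
      unfolding FTC(1) sum_subtractf[symmetric]
      by (intro sum.cong refl) (simp add: Q_def algebra_simps)
  qed
  have "(\<Sum>i\<in>I. \<Sum>j\<in>I. c i * c j * Q i j) = (\<Sum>i\<in>I. c i * (\<integral>x. indicator {a..u i} x * h x \<partial>N))"
    by (intro sum.cong) (auto simp: outer(1) sum_distrib_left mult.assoc)
  also have "\<dots> = (\<Sum>i\<in>I. \<integral>x. c i * (indicator {a..u i} x * h x) \<partial>N)"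
    by simp
  also have "\<dots> = (\<integral>x. (\<Sum>i\<in>I. c i * (indicator {a..u i} x * h x)) \<partial>N)"
    by (rule Bochner_Integration.integral_sum[symmetric]) (use outer(2) in auto)
  also have "\<dots> = (\<integral>x. f x * h x \<partial>N)"
    by (simp add: f_def sum_distrib_right mult.assoc)
  finally have Q: "(\<Sum>i\<in>I. \<Sum>j\<in>I. c i * c j * Q i j) = (\<integral>x. f x * h x \<partial>N)" .
  define B where "B = (\<integral>x. \<bar>f x\<bar> \<partial>N)"
  have B: "0 \<le> B" by (simp add: B_def)
  have K: "0 \<le> heat_kernel 2 z" "heat_kernel 2 z \<le> 1 / (2 * sqrt pi)" for z
    using heat_kernel_bounds[of 2 z] by (auto simp: real_sqrt_mult)
  have mK: "(\<lambda>y. heat_kernel 2 (x - y)) \<in> borel_measurable N" for x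
    unfolding N_def heat_kernel_def by (intro measurable_restrict_space1) measurable
  \<comment> \<open>The uniform bound on \<open>h\<close> costs one L1 norm of \<open>f\<close>, the
    pairing with \<open>f\<close> a second one. Each costs sqrt (b - a) against the L2 norm, hence
    the factor b - a.\<close>
  have hB: "\<bar>h x\<bar> \<le> 1 / (2 * sqrt pi) * B" for x
  proof -
    have "\<bar>h x\<bar> \<le> (\<integral>y. \<bar>f y * heat_kernel 2 (x - y)\<bar> \<partial>N)"
      unfolding h_def by (rule integral_abs_bound)
    also have "\<dots> \<le> (\<integral>y. 1 / (2 * sqrt pi) * \<bar>f y\<bar> \<partial>N)"
    proof (rule integral_mono')
      show "integrable N (\<lambda>y. 1 / (2 * sqrt pi) * \<bar>f y\<bar>)" using fi by simp
      show "\<bar>f y * heat_kernel 2 (x - y)\<bar> \<le> 1 / (2 * sqrt pi) * \<bar>f y\<bar>" for y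
        using mult_right_mono[OF K(2), of "\<bar>f y\<bar>" "x - y"] K(1) by (simp add: abs_mult mult.commute)
    qed simp
    also have "\<dots> = 1 / (2 * sqrt pi) * B" unfolding B_def by (rule integral_mult_right_zero)
    finally show ?thesis .
  qed
  have "\<bar>\<integral>x. f x * h x \<partial>N\<bar> \<le> (\<integral>x. \<bar>f x * h x\<bar> \<partial>N)" by (rule integral_abs_bound)
  also have "\<dots> \<le> (\<integral>x. 1 / (2 * sqrt pi) * B * \<bar>f x\<bar> \<partial>N)"
  proof (rule integral_mono')
    show "integrable N (\<lambda>y. 1 / (2 * sqrt pi) * B * \<bar>f y\<bar>)" using fi by simp
    show "\<bar>f x * h x\<bar> \<le> 1 / (2 * sqrt pi) * B * \<bar>f x\<bar>" for x
      using mult_right_mono[OF hB, of "\<bar>f x\<bar>" x] by (simp add: abs_mult mult.commute)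
  qed (use B in simp)
  also have "\<dots> = 1 / (2 * sqrt pi) * B * B" unfolding B_def by (rule integral_mult_right_zero)
  also have "\<dots> = 1 / (2 * sqrt pi) * B\<^sup>2" by (simp add: power2_eq_square)
  also have "\<dots> \<le> 1 / (2 * sqrt pi) * (sqrt (b - a) * L2_norm N f)\<^sup>2"
  proof (intro mult_left_mono power_mono B)
    show "B \<le> sqrt (b - a) * L2_norm N f"
      using integral_abs_le_L2_norm(2)[OF N.finite_measure_axioms fL] measure_interval_lborel[OF \<open>a \<le> b\<close>]
      by (simp add: B_def N_def)
  qed simp
  also have "\<dots> = (b - a) / (2 * sqrt pi) * (L2_norm N f)\<^sup>2"
    using \<open>a \<le> b\<close> by (simp add: power_mult_distrib)
  finally show ?thesis using Q by (simp add: Q_def)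
qed

text \<open>The covariance \<open>r(u - w)\<close> of \<open>x\<close> satisfies \<open>r'' = p\<^sub>2 - \<delta>\<close>. The delta function contributes the
  norm of the step function, the kernel \<open>p\<^sub>2\<close> an error controlled by \<open>sup p\<^sub>2 = 1 / (2 \<surd>\<pi>)\<close>.\<close>

lemma heat_increment_norm:
  fixes M :: "'w measure" and c u :: "'i \<Rightarrow> real"
  assumes "gaussian_measure M (restrict_space lborel (UNIV \<times> {0..1})) W" and "a \<le> b"
    and x: "\<And>u. u \<in> {a..b} \<Longrightarrow>
      has_noise_integral M (restrict_space lborel (UNIV \<times> {0..1})) W
        (\<lambda>(v, s). heat_kernel (1 - s) (u - v)) (x u)"
    and I: "finite I" "\<And>i. i \<in> I \<Longrightarrow> u i \<in> {a..b}"
  shows "centered_gaussian M (\<lambda>\<omega>. \<Sum>i\<in>I. c i * (x (u i) \<omega> - x a \<omega>))"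
    and "\<bar>(L2_norm M (\<lambda>\<omega>. \<Sum>i\<in>I. c i * (x (u i) \<omega> - x a \<omega>)))\<^sup>2
        - (L2_norm (interval_lborel a b) (\<lambda>x. \<Sum>i\<in>I. c i * indicator {a..u i} x))\<^sup>2\<bar>
      \<le> (b - a) / (2 * sqrt pi)
        * (L2_norm (interval_lborel a b) (\<lambda>x. \<Sum>i\<in>I. c i * indicator {a..u i} x))\<^sup>2"
proof -
  let ?\<mu> = "restrict_space lborel (UNIV \<times> {0..1}) :: (real \<times> real) measure"
  let ?k = "\<lambda>u (v, s). heat_kernel (1 - s) (u - v)"
  let ?N = "interval_lborel a b"
  let ?g = "\<lambda>i z. ?k (u i) z - ?k a z"
  interpret gaussian_measure M ?\<mu> W by fact
  have kL: "?k w \<in> L2_space ?\<mu>" if "w \<in> {a..b}" for w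
    using x[OF that] by (simp add: has_noise_integral_def)
  have a: "a \<in> {a..b}" using \<open>a \<le> b\<close> by simp
  have gL: "?g i \<in> L2_space ?\<mu>" if "i \<in> I" for i
    by (rule L2_space_diff[OF kL[OF I(2)[OF that]] kL[OF a]])
  have "has_noise_integral M ?\<mu> W (?g i) (\<lambda>\<omega>. x (u i) \<omega> - x a \<omega>)" if "i \<in> I" for i
    using has_noise_integral_add[OF x[OF I(2)[OF that]] has_noise_integral_scale[OF x[OF a], of "-1"]]
    by simp
  note n = has_noise_integral_isometry[OF has_noise_integral_sum[OF I(1) this, where c = c]]
  show "centered_gaussian M (\<lambda>\<omega>. \<Sum>i\<in>I. c i * (x (u i) \<omega> - x a \<omega>))" by (rule n(2))
  define Q where "Q i j = heat_potential (u i - a) - heat_potential (u i - u j)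
      - heat_potential 0 + heat_potential (a - u j)" for i j
  have gg: "L2_inner ?\<mu> (?g i) (?g j) = min (u i) (u j) - a - Q i j" if "i \<in> I" "j \<in> I" for i j
    unfolding Q_def using I(2)[OF that(1)] I(2)[OF that(2)]
    by (intro heat_kernel_increment_inner kL) (auto simp: a)
  have "(L2_norm M (\<lambda>\<omega>. \<Sum>i\<in>I. c i * (x (u i) \<omega> - x a \<omega>)))\<^sup>2
    = (L2_norm ?\<mu> (\<lambda>z. \<Sum>i\<in>I. c i * ?g i z))\<^sup>2"
    by (simp only: n(1))
  also have "\<dots> = (\<Sum>i\<in>I. \<Sum>j\<in>I. c i * c j * L2_inner ?\<mu> (?g i) (?g j))"
    unfolding L2_norm_sq by (rule L2_inner_sum_sum[OF gL])
  also have "\<dots> = (\<Sum>i\<in>I. \<Sum>j\<in>I. c i * c j * (min (u i) (u j) - a - Q i j))"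
    by (intro sum.cong refl) (simp only: gg)
  also have "\<dots> = (\<Sum>i\<in>I. \<Sum>j\<in>I. c i * c j * (min (u i) (u j) - a)) - (\<Sum>i\<in>I. \<Sum>j\<in>I. c i * c j * Q i j)"
    by (simp add: right_diff_distrib sum_subtractf)
  also have "(\<Sum>i\<in>I. \<Sum>j\<in>I. c i * c j * (min (u i) (u j) - a))
    = (L2_norm ?N (\<lambda>x. \<Sum>i\<in>I. c i * indicator {a..u i} x))\<^sup>2"
    unfolding L2_norm_sq
    by (subst L2_inner_sum_sum) (use I(2) in \<open>auto simp: indicator_interval_L2 L2_inner_indicator_interval\<close>)
  finally show "\<bar>(L2_norm M (\<lambda>\<omega>. \<Sum>i\<in>I. c i * (x (u i) \<omega> - x a \<omega>)))\<^sup>2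
        - (L2_norm ?N (\<lambda>x. \<Sum>i\<in>I. c i * indicator {a..u i} x))\<^sup>2\<bar>
      \<le> (b - a) / (2 * sqrt pi) * (L2_norm ?N (\<lambda>x. \<Sum>i\<in>I. c i * indicator {a..u i} x))\<^sup>2"
    using heat_quadratic_form[OF \<open>a \<le> b\<close> I, where c = c] by (simp add: Q_def)
qed

section \<open>Partitions and the integrator inequality\<close>

lemma partition_mono:
  fixes u :: "nat \<Rightarrow> real"
  assumes "\<And>k. k < n \<Longrightarrow> u k < u (Suc k)" "j \<le> k" "k \<le> n"
  shows "u j \<le> u k"
  using assms(2,3)
proof (induction rule: dec_induct)
  case (step m)
  then show ?case using assms(1)[of m] by simp
qed simp

text \<open>Differences of indicators of closed intervals with common left end \<open>a\<close> are
  indicators of half-open intervals. These are disjoint even at the partition points, hence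
  orthogonal.\<close>

lemma L2_norm_partition_step:
  fixes u \<alpha> :: "nat \<Rightarrow> real"
  assumes u: "u 0 = a" "u n = b" "\<And>k. k < n \<Longrightarrow> u k < u (Suc k)"
  shows "(L2_norm (interval_lborel a b)
      (\<lambda>x. \<Sum>k<n. \<alpha> k * (indicator {a..u (Suc k)} x - indicator {a..u k} x)))\<^sup>2
    = (\<Sum>k<n. (\<alpha> k)\<^sup>2 * (u (Suc k) - u k))"
proof -
  have mono: "u j \<le> u k" if "j \<le> k" "k \<le> n" for j k
    using that partition_mono u(3) by blast
  let ?J = "\<lambda>k. indicator {u k<..u (Suc k)} :: real \<Rightarrow> real"
  have J: "indicator {a..u (Suc k)} x - indicator {a..u k} x = ?J k x" if "k < n" for k x
    using that mono[of 0 k] u by (fastforce simp: indicator_def)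
  have disj: "?J i x * ?J j x = 0" if "i < n" "j < n" "i \<noteq> j" for i j x
  proof -
    have "u (Suc i) \<le> u j \<or> u (Suc j) \<le> u i"
      using that mono[of "Suc i" j] mono[of "Suc j" i] by (cases "i < j") auto
    then show ?thesis by (auto simp: indicator_def)
  qed
  have JJ0: "L2_inner (interval_lborel a b) (?J i) (?J j) = 0" if "i < n" "j < n" "i \<noteq> j" for i j
    by (simp only: L2_inner_def disj[OF that]) simp
  have JL: "?J k \<in> L2_space (interval_lborel a b)" if "k < n" for k
  proof -
    have "?J k = (\<lambda>x. indicator {a..u (Suc k)} x - indicator {a..u k} x)"
      by (rule ext) (simp add: J that)
    then show ?thesis by (simp only: L2_space_diff indicator_interval_L2)
  qed
  have JJ: "L2_inner (interval_lborel a b) (?J k) (?J k) = u (Suc k) - u k" if "k < n" for k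
  proof -
    have "L2_inner (interval_lborel a b) (?J k) (?J k) = (\<integral>x. ?J k x \<partial>lborel)"
      unfolding L2_inner_def integral_interval_lborel
      using mono[of 0 k] mono[of "Suc k" n] that u
      by (intro Bochner_Integration.integral_cong) (auto simp: indicator_def)
    then show ?thesis using u(3)[OF that] by simp
  qed
  have "(L2_norm (interval_lborel a b)
      (\<lambda>x. \<Sum>k<n. \<alpha> k * (indicator {a..u (Suc k)} x - indicator {a..u k} x)))\<^sup>2
    = L2_inner (interval_lborel a b) (\<lambda>x. \<Sum>k<n. \<alpha> k * ?J k x) (\<lambda>x. \<Sum>k<n. \<alpha> k * ?J k x)"
    unfolding L2_norm_sq using J by (simp cong: sum.cong_simp)
  also have "\<dots> = (\<Sum>i<n. \<Sum>j<n. \<alpha> i * \<alpha> j * L2_inner (interval_lborel a b) (?J i) (?J j))"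
    by (rule L2_inner_sum_sum) (use JL in auto)
  also have "\<dots> = (\<Sum>i<n. \<Sum>j<n. if j = i then (\<alpha> i)\<^sup>2 * (u (Suc i) - u i) else 0)"
    by (intro sum.cong refl) (auto simp: JJ JJ0 power2_eq_square)
  finally show ?thesis by simp
qed

lemma heat_gaussian_integrator:
  fixes M :: "'w measure"
  assumes "gaussian_measure M (restrict_space lborel (UNIV \<times> {0..1})) W" and "a \<le> b"
    and x: "\<And>u. u \<in> {a..b} \<Longrightarrow>
      has_noise_integral M (restrict_space lborel (UNIV \<times> {0..1})) W
        (\<lambda>(v, s). heat_kernel (1 - s) (u - v)) (x u)"
  shows "gaussian_integrator M a b (\<lambda>u \<omega>. x u \<omega> - x a \<omega>)"
  unfolding gaussian_integrator_def
proof (intro conjI exI allI impI)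
  note H = heat_increment_norm[OF assms]
  show "centered_gaussian_family M {a..b} (\<lambda>u \<omega>. x u \<omega> - x a \<omega>)"
    unfolding centered_gaussian_family_def
    by (intro allI impI, rule H(1)[where u = "\<lambda>t. t"]) auto
  show "AE \<omega> in M. x a \<omega> - x a \<omega> = 0" by simp
  \<comment> \<open>The upper half of the two-sided estimate: 1 for the norm of the step function,
    the rest for the kernel term.\<close>
  let ?C = "1 + (b - a) / (2 * sqrt pi)"
  show "0 < ?C" using \<open>a \<le> b\<close> by (intro add_pos_nonneg) auto
  fix n :: nat and u \<alpha> :: "nat \<Rightarrow> real"
  assume "u 0 = a \<and> u n = b \<and> (\<forall>k<n. u k < u (Suc k))"
  then have u: "u 0 = a" "u n = b" "\<And>k. k < n \<Longrightarrow> u k < u (Suc k)" by auto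
  have uab: "u k \<in> {a..b}" if "k \<le> n" for k
    using partition_mono[of n u 0 k, OF u(3)] partition_mono[of n u k n, OF u(3)] that
    unfolding atLeastAtMost_iff u(1,2) by blast
  have abs_bound: "A \<le> (1 + d) * F" if "\<bar>A - F\<bar> \<le> d * F" for A d F :: real
    using that by (simp add: distrib_right)
  \<comment> \<open>Each increment is split into its two evaluations, marked by a boolean:
    \<open>True\<close> is the right end with coefficient \<open>\<alpha> k\<close>,
    \<open>False\<close> the left end with the opposite sign. This gives combinations of increments
    from \<open>a\<close>, to which the estimate applies.\<close>
  let ?I = "{..<n} \<times> (UNIV :: bool set)"
  let ?c = "\<lambda>(k, e). if e then \<alpha> k else - \<alpha> k" and ?u = "\<lambda>(k, e). if e then u (Suc k) else u k"
  have pairs: "(\<Sum>i\<in>?I. ?c i * F (?u i)) = (\<Sum>k<n. \<alpha> k * (F (u (Suc k)) - F (u k)))"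
    for F :: "real \<Rightarrow> real"
  proof -
    have "(\<Sum>i\<in>?I. ?c i * F (?u i)) = (\<Sum>k<n. \<Sum>e\<in>UNIV. ?c (k, e) * F (?u (k, e)))"
      unfolding sum.cartesian_product by (rule sum.cong) auto
    then show ?thesis by (simp add: UNIV_bool algebra_simps)
  qed
  have uI: "?u i \<in> {a..b}" if "i \<in> ?I" for i
    using that uab[of "fst i"] uab[of "Suc (fst i)"] by (cases i) (auto simp del: atLeastAtMost_iff)
  have "(\<integral>\<omega>. (\<Sum>k<n. \<alpha> k * ((x (u (Suc k)) \<omega> - x a \<omega>) - (x (u k) \<omega> - x a \<omega>)))\<^sup>2 \<partial>M)
    = (L2_norm M (\<lambda>\<omega>. \<Sum>i\<in>?I. ?c i * (x (?u i) \<omega> - x a \<omega>)))\<^sup>2"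
    unfolding pairs[where F = "\<lambda>w. x w \<omega> - x a \<omega>" for \<omega>] L2_norm_sq
    by (simp add: L2_inner_def power2_eq_square)
  also have "\<dots> \<le> ?C * (L2_norm (interval_lborel a b) (\<lambda>y. \<Sum>i\<in>?I. ?c i * indicator {a..?u i} y))\<^sup>2"
    by (rule abs_bound, rule H(2)) (use uI in auto)
  also have "\<dots> = ?C * (\<Sum>k<n. (\<alpha> k)\<^sup>2 * (u (Suc k) - u k))"
    unfolding pairs[where F = "\<lambda>w. indicator {a..w} y" for y]
    by (rule arg_cong[where f = "\<lambda>t. ?C * t"], rule L2_norm_partition_step) (fact u)+
  finally show "(\<integral>\<omega>. (\<Sum>k<n. \<alpha> k * ((x (u (Suc k)) \<omega> - x a \<omega>) - (x (u k) \<omega> - x a \<omega>)))\<^sup>2 \<partial>M)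
    \<le> ?C * (\<Sum>k<n. (\<alpha> k)\<^sup>2 * (u (Suc k) - u k))" .
qed

section \<open>Density of step functions\<close>

lemma L2_space_bounded:
  assumes "g \<in> L2_space N" "f \<in> borel_measurable N" "\<And>x. x \<in> space N \<Longrightarrow> \<bar>f x\<bar> \<le> \<bar>g x\<bar>"
  shows "f \<in> L2_space N"
proof -
  have "integrable N (\<lambda>x. (f x)\<^sup>2)"
    by (rule Bochner_Integration.integrable_bound[where f = "\<lambda>x. (g x)\<^sup>2"])
      (use assms in \<open>auto simp: L2_space_def abs_le_square_iff\<close>)
  then show ?thesis using assms(2) by (simp add: L2_space_def)
qed

lemma L2_dominated_convergence:
  assumes "g \<in> L2_space N" and F[measurable]: "\<And>k. F k \<in> borel_measurable N" "f \<in> borel_measurable N"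
    and bound: "\<And>k x. x \<in> space N \<Longrightarrow> \<bar>F k x\<bar> \<le> g x"
    and lim: "\<And>x. x \<in> space N \<Longrightarrow> (\<lambda>k. F k x) \<longlonglongrightarrow> f x"
  shows "f \<in> L2_space N" "(\<lambda>k. L2_norm N (\<lambda>x. F k x - f x)) \<longlonglongrightarrow> 0"
proof -
  have fg: "\<bar>f x\<bar> \<le> g x" if "x \<in> space N" for x
    by (rule LIMSEQ_le_const2[OF tendsto_rabs[OF lim[OF that]]]) (use bound[OF that] in auto)
  show fL: "f \<in> L2_space N"
    by (rule L2_space_bounded[OF assms(1)]) (use fg in \<open>force+\<close>)
  have "(\<lambda>k. \<integral>x. (F k x - f x)\<^sup>2 \<partial>N) \<longlonglongrightarrow> (\<integral>x. 0 \<partial>N)"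
  proof (rule integral_dominated_convergence[where w = "\<lambda>x. (2 * g x)\<^sup>2"])
    show "integrable N (\<lambda>x. (2 * g x)\<^sup>2)"
      using assms(1) by (auto simp: L2_space_def power_mult_distrib)
    show "AE x in N. (\<lambda>k. (F k x - f x)\<^sup>2) \<longlonglongrightarrow> 0"
    proof (rule AE_I2)
      fix x assume "x \<in> space N"
      from tendsto_power[OF tendsto_diff[OF lim[OF this] tendsto_const[of "f x"]], of 2]
      show "(\<lambda>k. (F k x - f x)\<^sup>2) \<longlonglongrightarrow> 0" by simp
    qed
    show "AE x in N. norm ((F k x - f x)\<^sup>2) \<le> (2 * g x)\<^sup>2" for k
    proof (rule AE_I2)
      fix x assume x: "x \<in> space N"
      have "\<bar>F k x - f x\<bar> \<le> \<bar>2 * g x\<bar>" using bound[OF x, of k] fg[OF x] by linarith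
      then show "norm ((F k x - f x)\<^sup>2) \<le> (2 * g x)\<^sup>2" by (simp only: abs_le_square_iff) simp
    qed
  qed auto
  then have "(\<lambda>k. sqrt (\<integral>x. (F k x - f x)\<^sup>2 \<partial>N)) \<longlonglongrightarrow> sqrt 0"
    by (intro tendsto_real_sqrt) simp
  then show "(\<lambda>k. L2_norm N (\<lambda>x. F k x - f x)) \<longlonglongrightarrow> 0"
    by (simp add: L2_norm_def L2_inner_def power2_eq_square)
qed

text \<open>A monotone class argument in which pointwise increasing limits become mean square
  limits, the limit itself being the dominating function.\<close>

lemma L2_space_induct:
  assumes "f \<in> L2_space N"
    and ind: "\<And>B. B \<in> sets N \<Longrightarrow> indicator B \<in> V"
    and scale: "\<And>c g. g \<in> V \<Longrightarrow> (\<lambda>x. c * g x) \<in> V"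
    and add: "\<And>g h. g \<in> V \<Longrightarrow> h \<in> V \<Longrightarrow> (\<lambda>x. g x + h x) \<in> V"
    and lim: "\<And>F g. (\<And>k. F k \<in> V) \<Longrightarrow> g \<in> L2_space N
      \<Longrightarrow> (\<lambda>k. L2_norm N (\<lambda>x. F k x - g x)) \<longlonglongrightarrow> 0 \<Longrightarrow> g \<in> V"
  shows "f \<in> V"
proof -
  \<comment> \<open>The induction runs over all nonnegative measurable functions, so square
    integrability sits inside the induction statement and is inherited by the smaller
    pieces.\<close>
  have pos: "g \<in> L2_space N \<longrightarrow> g \<in> V" if "g \<in> borel_measurable N" "\<And>x. 0 \<le> g x" for g
    using that
  proof (induction rule: borel_measurable_induct_real)
    case (set B)
    then show ?case using ind by simp
  next
    case (mult g c)
    show ?case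
    \<comment> \<open>Square integrability passes from \<open>c * g\<close> to \<open>g\<close> by
      division. This fails at c = 0, where the zero function comes from the empty set
      instead.\<close>
    proof (cases "c = 0")
      case True
      then show ?thesis using scale[OF ind[OF sets.empty_sets], of 0] by simp
    next
      case False
      show ?thesis
      proof
        assume "(\<lambda>x. c * g x) \<in> L2_space N"
        from L2_space_scale[OF this, of "1 / c"] have "g \<in> L2_space N" using False by simp
        then show "(\<lambda>x. c * g x) \<in> V" using mult scale by blast
      qed
    qed
  next
    case (add g h)
    show ?case
    proof
      assume s: "(\<lambda>x. h x + g x) \<in> L2_space N"
      have "g \<in> L2_space N" "h \<in> L2_space N"
        by (rule L2_space_bounded[OF s]; use add in \<open>simp add: abs_of_nonneg\<close>)+
      then show "(\<lambda>x. h x + g x) \<in> V" using add assms(4) by blast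
    qed
  next
    case (seq U)
    show ?case
    proof
      assume g: "g \<in> L2_space N"
      have U: "U i \<in> borel_measurable N" "0 \<le> U i x" "U i \<in> L2_space N \<longrightarrow> U i \<in> V" "incseq U" for i x
        by (rule seq)+
      have Ulim: "(\<lambda>i. U i x) \<longlonglongrightarrow> g x" if "x \<in> space N" for x
        by (rule seq) (rule that)
      have le: "\<bar>U i x\<bar> \<le> g x" if "x \<in> space N" for i x
        unfolding abs_of_nonneg[OF U(2)]
        by (rule incseq_le[OF _ Ulim[OF that]]) (use U(4) in \<open>simp add: incseq_def le_fun_def\<close>)
      have "U i \<in> L2_space N" for i
        by (rule L2_space_bounded[OF g U(1)]) (use le abs_ge_self order_trans in blast)
      then have UV: "U i \<in> V" for i using U(3) by blast
      have "(\<lambda>k. L2_norm N (\<lambda>x. U k x - g x)) \<longlonglongrightarrow> 0"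
        by (rule L2_dominated_convergence(2)[OF g U(1) L2_space_measurable[OF g] le Ulim])
      from lim[OF UV g this] show "g \<in> V" .
    qed
  qed
  have fp: "(\<lambda>x. max (f x) 0) \<in> L2_space N" "(\<lambda>x. max (- f x) 0) \<in> L2_space N"
    by (rule L2_space_bounded[OF assms(1)]; use L2_space_measurable[OF assms(1)] in auto)+
  have "(\<lambda>x. max (f x) 0) \<in> V" "(\<lambda>x. max (- f x) 0) \<in> V"
    by (rule pos[THEN mp]; use fp L2_space_measurable in auto)+
  from add[OF this(1) scale[OF this(2), of "-1"]]
  have "(\<lambda>x. max (f x) 0 + - 1 * max (- f x) 0) \<in> V" .
  also have "(\<lambda>x. max (f x) 0 + - 1 * max (- f x) 0) = f" by (auto simp: max_def)
  finally show ?thesis .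
qed

text \<open>Half-lines generate the Borel sets and are stable under intersection, and on
  \<open>{a..b}\<close> each agrees with some \<open>{a..u}\<close> or with the empty set; Dynkin's
  theorem then reaches all Borel sets.\<close>

lemma L2_interval_induct:
  assumes "a \<le> b" "f \<in> L2_space (interval_lborel a b)"
    and ind: "\<And>u. u \<in> {a..b} \<Longrightarrow> indicator {a..u} \<in> V"
    and scale: "\<And>c g. g \<in> V \<Longrightarrow> (\<lambda>x. c * g x) \<in> V"
    and add: "\<And>g h. g \<in> V \<Longrightarrow> h \<in> V \<Longrightarrow> (\<lambda>x. g x + h x) \<in> V"
    and lim: "\<And>F g. (\<And>k. F k \<in> V) \<Longrightarrow> g \<in> L2_space (interval_lborel a b)
      \<Longrightarrow> (\<lambda>k. L2_norm (interval_lborel a b) (\<lambda>x. F k x - g x)) \<longlonglongrightarrow> 0 \<Longrightarrow> g \<in> V"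
  shows "f \<in> V"
proof (rule L2_space_induct[OF assms(2) _ scale add lim])
  let ?N = "interval_lborel a b"
  interpret finite_measure ?N by (rule finite_measure_interval_lborel)
  have sp: "space ?N = {a..b}" by (simp add: space_restrict_space)
  have meas: "(indicator S :: real \<Rightarrow> real) \<in> borel_measurable ?N" if "S \<in> sets borel" for S
    using that by (intro measurable_restrict_space1) auto
  have one: "(\<lambda>x. 1) \<in> L2_space ?N" by (simp add: L2_space_def)
  have L: "indicator S \<in> L2_space ?N" if "S \<in> sets borel" for S
    by (rule L2_space_bounded[OF one meas[OF that]]) (auto simp: indicator_def)
  \<comment> \<open>Functions live on the whole line while only their values on
    \<open>{a..b}\<close> count. Closure under limits, used with a constant sequence, makes
    \<open>V\<close> blind to the values outside.\<close>
  have cong: "g \<in> V" if "h \<in> V" "g \<in> L2_space ?N" "\<And>x. x \<in> {a..b} \<Longrightarrow> h x = g x" for g h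
  proof (rule lim[of "\<lambda>_. h"])
    have "L2_norm ?N (\<lambda>x. h x - g x) = L2_norm ?N (\<lambda>x. 0)"
      unfolding L2_norm_def L2_inner_def
      by (intro arg_cong[where f = sqrt] Bochner_Integration.integral_cong) (use that sp in auto)
    then show "(\<lambda>k. L2_norm ?N (\<lambda>x. h x - g x)) \<longlonglongrightarrow> 0" by (simp add: L2_norm_def L2_inner_def)
  qed (use that in auto)
  have zero: "(\<lambda>x. 0) \<in> V" using scale[OF ind[of a], of 0] \<open>a \<le> b\<close> by simp
  fix B assume "B \<in> sets ?N"
  then have "B \<in> sets borel" by (auto simp: sets_restrict_space)
  let ?G = "range (\<lambda>u::real. {..u})"
  have G: "sigma_sets UNIV ?G = sets borel" by (subst borel_eq_atMost) simp
  have "Int_stable ?G" by (auto simp: Int_stable_def)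
  moreover have "?G \<subseteq> Pow UNIV" by simp
  moreover have "B \<in> sigma_sets UNIV ?G" using \<open>B \<in> sets borel\<close> G by simp
  ultimately show "indicator B \<in> V"
  proof (induction rule: sigma_sets_induct_disjoint)
    case (basic S)
    then obtain u where S: "S = {..u}" by auto
    show ?case
    proof (cases "u < a")
      case True
      show ?thesis by (rule cong[OF zero L]) (use S True in \<open>auto simp: indicator_def\<close>)
    next
      case False
      show ?thesis
        by (rule cong[OF ind[of "min u b"] L]) (use S False \<open>a \<le> b\<close> in \<open>auto simp: indicator_def\<close>)
    qed
  next
    case empty
    show ?case by (rule cong[OF zero L]) auto
  next
    \<comment> \<open>Inside \<open>{a..b}\<close> the indicator of the complement is that of
      \<open>{a..b}\<close> minus that of \<open>S\<close>.\<close>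
    case (compl S)
    show ?case
      by (rule cong[OF add[OF ind[of b] scale[OF compl(2), of "-1"]] L])
        (use compl(1) \<open>a \<le> b\<close> in \<open>auto simp: indicator_def G\<close>)
  next
    case (union S)
    have [measurable]: "S i \<in> sets borel" for i using union(2) by (auto simp: G)
    have F: "(\<lambda>x. \<Sum>i<k. indicator (S i) x) \<in> V" for k
      by (induction k) (simp_all add: zero add union(3))
    have "(\<lambda>k. L2_norm ?N (\<lambda>x. (\<Sum>i<k. indicator (S i) x) - indicator (\<Union>i. S i) x)) \<longlonglongrightarrow> 0"
    proof (rule L2_dominated_convergence(2)[OF one])
      \<comment> \<open>Disjointness turns each partial sum into an indicator, so the constant 1
        dominates.\<close>
      have eq: "(\<Sum>i<k. indicator (S i) x :: real) = indicator (\<Union>i<k. S i) x" for k x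
        using union(1) by (intro indicator_UN_disjoint[symmetric]) (auto simp: disjoint_family_on_def)
      show "\<bar>\<Sum>i<k. indicator (S i) x :: real\<bar> \<le> 1" for k x
        unfolding eq by (simp add: indicator_def)
      show "(\<lambda>k. \<Sum>i<k. indicator (S i) x) \<longlonglongrightarrow> (indicator (\<Union>i. S i) x :: real)" for x
        unfolding eq by (rule LIMSEQ_indicator_UN)
    qed (auto intro!: meas borel_measurable_sum)
    from lim[OF F L this] show ?case by auto
  qed
qed

section \<open>Operators bounded below\<close>

lemma bounded_linear_L2D:
  assumes "bounded_linear_L2 N D T"
  shows "f \<in> D \<Longrightarrow> T f \<in> L2_space N"
    and "f \<in> D \<Longrightarrow> g \<in> D \<Longrightarrow> AE x in N. f x = g x \<Longrightarrow> AE x in N. T f x = T g x"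
    and "f \<in> D \<Longrightarrow> g \<in> D \<Longrightarrow> AE x in N. T (\<lambda>y. f y + g y) x = T f x + T g x"
    and "f \<in> D \<Longrightarrow> AE x in N. T (\<lambda>y. c * f y) x = c * T f x"
  using assms unfolding bounded_linear_L2_def by blast+

lemma bounded_linear_L2_diff:
  assumes T: "bounded_linear_L2 N (L2_space N) T" and "f \<in> L2_space N" "g \<in> L2_space N"
  shows "AE x in N. T (\<lambda>y. f y - g y) x = T f x - T g x"
  using bounded_linear_L2D(3)[OF T assms(2) L2_space_scale[OF assms(3), of "-1"]]
    bounded_linear_L2D(4)[OF T assms(3), of "-1"]
  by eventually_elim simp

lemma bounded_linear_L2_sum:
  assumes T: "bounded_linear_L2 N (L2_space N) T" and "\<And>i. i < n \<Longrightarrow> f i \<in> L2_space N"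
  shows "AE x in N. T (\<lambda>y. \<Sum>i<(n::nat). c i * f i y) x = (\<Sum>i<n. c i * T (f i) x)"
  using assms(2)
proof (induction n)
  case 0
  show ?case using bounded_linear_L2D(4)[OF T L2_space_zero, of 0] by simp
next
  case (Suc n)
  have "(\<lambda>y. \<Sum>i<n. c i * f i y) \<in> L2_space N" "(\<lambda>y. c n * f n y) \<in> L2_space N"
    using Suc.prems by (auto intro!: L2_space_sum L2_space_scale)
  note add = bounded_linear_L2D(3)[OF T this] bounded_linear_L2D(4)[OF T Suc.prems[OF lessI], of "c n"]
  have "AE x in N. T (\<lambda>y. \<Sum>i<n. c i * f i y) x = (\<Sum>i<n. c i * T (f i) x)"
    by (rule Suc.IH) (simp add: Suc.prems)
  with add show ?case unfolding sum.lessThan_Suc by eventually_elim simp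
qed

lemma bounded_linear_L2_norm_diff:
  assumes T: "bounded_linear_L2 N (L2_space N) T" and "f \<in> L2_space N" "g \<in> L2_space N"
  shows "L2_norm N (\<lambda>x. T f x - T g x) = L2_norm N (T (\<lambda>x. f x - g x))"
proof (rule L2_norm_cong_AE)
  show "(\<lambda>x. T f x - T g x) \<in> borel_measurable N" "T (\<lambda>x. f x - g x) \<in> borel_measurable N"
    by (intro L2_space_measurable L2_space_diff bounded_linear_L2D(1)[OF T] assms)+
  show "AE x in N. T f x - T g x = T (\<lambda>x. f x - g x) x"
    using bounded_linear_L2_diff[OF assms] by eventually_elim simp
qed

context
  fixes N :: "'a measure" and T and \<kappa> :: real
  assumes T: "bounded_linear_L2 N (L2_space N) T"
    and below: "\<kappa> > 0" "\<And>f. f \<in> L2_space N \<Longrightarrow> \<kappa> * L2_norm N f \<le> L2_norm N (T f)"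
begin

lemma bounded_below_AE_inj:
  assumes "f \<in> L2_space N" "g \<in> L2_space N" "AE x in N. T f x = T g x"
  shows "AE x in N. f x = g x"
proof -
  have d: "(\<lambda>x. f x - g x) \<in> L2_space N" using assms L2_space_diff by blast
  have m: "T f \<in> borel_measurable N" "T g \<in> borel_measurable N"
    using assms bounded_linear_L2D(1)[OF T] L2_space_measurable by auto
  have "L2_norm N (T (\<lambda>x. f x - g x)) = L2_norm N (\<lambda>x. T f x - T g x)"
    using bounded_linear_L2_norm_diff[OF T assms(1,2)] by simp
  also have "\<dots> = L2_norm N (\<lambda>x. 0)"
    using assms(3) m by (intro L2_norm_cong_AE) auto
  finally have "\<kappa> * L2_norm N (\<lambda>x. f x - g x) \<le> 0"
    using below(2)[OF d] by (simp add: L2_norm_def L2_inner_def)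
  then have "L2_norm N (\<lambda>x. f x - g x) = 0"
    using below(1) L2_norm_nonneg[of N "\<lambda>x. f x - g x"]
    by (simp add: mult_le_0_iff order_antisym)
  from L2_norm_eq_0_AE[OF d this] show ?thesis by simp
qed

text \<open>The inverse picks any preimage. The lower bound makes preimages unique almost
  everywhere, so each algebraic clause on \<open>S\<close> follows by exhibiting some preimage;
  applied to \<open>S f\<close> it also gives the norm bound 1 / \<kappa>.\<close>

lemma bounded_below_continuously_invertible: "continuously_invertible_L2 N T"
proof -
  define S where "S g = (SOME f. f \<in> L2_space N \<and> (AE x in N. T f x = g x))" for g
  have S: "S g \<in> L2_space N" "AE x in N. T (S g) x = g x" if "g \<in> L2_range N T" for g
  proof -
    have "\<exists>f. f \<in> L2_space N \<and> (AE x in N. T f x = g x)" using that by (auto simp: L2_range_def)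
    from someI_ex[OF this] show "S g \<in> L2_space N" "AE x in N. T (S g) x = g x"
      by (simp_all only: S_def)
  qed
  have SI: "AE x in N. S g x = f x" if "g \<in> L2_range N T" "f \<in> L2_space N" "AE x in N. T f x = g x" for f g
    by (rule bounded_below_AE_inj[OF S(1)[OF that(1)] that(2)])
      (use S(2)[OF that(1)] that(3) in \<open>eventually_elim, simp\<close>)
  have range: "g \<in> L2_range N T" if "g \<in> L2_space N" "f \<in> L2_space N" "AE x in N. T f x = g x" for f g
    using that by (auto simp: L2_range_def)
  have RL: "g \<in> L2_space N" if "g \<in> L2_range N T" for g using that by (simp add: L2_range_def)
  have "bounded_linear_L2 N (L2_range N T) S"
    unfolding bounded_linear_L2_def
  proof (intro conjI ballI allI impI)
    fix f assume "f \<in> L2_range N T" then show "S f \<in> L2_space N" by (rule S)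
  next
    fix f g assume fg: "f \<in> L2_range N T" "g \<in> L2_range N T" and ae: "AE x in N. f x = g x"
    show "AE x in N. S f x = S g x"
      by (rule SI[OF fg(1) S(1)[OF fg(2)]]) (use S(2)[OF fg(2)] ae in \<open>eventually_elim, simp\<close>)
  next
    fix f g assume fg: "f \<in> L2_range N T" "g \<in> L2_range N T"
    have L: "(\<lambda>x. S f x + S g x) \<in> L2_space N" by (intro L2_space_add S fg)
    have ae: "AE x in N. T (\<lambda>x. S f x + S g x) x = f x + g x"
      using bounded_linear_L2D(3)[OF T S(1)[OF fg(1)] S(1)[OF fg(2)]] S(2)[OF fg(1)] S(2)[OF fg(2)]
      by eventually_elim simp
    show "AE x in N. S (\<lambda>y. f y + g y) x = S f x + S g x"
      by (rule SI[OF range[OF _ L ae] L ae]) (intro L2_space_add RL fg)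
  next
    fix c f assume f: "f \<in> L2_range N T"
    have L: "(\<lambda>x. c * S f x) \<in> L2_space N" by (intro L2_space_scale S f)
    have ae: "AE x in N. T (\<lambda>x. c * S f x) x = c * f x"
      using bounded_linear_L2D(4)[OF T S(1)[OF f], of c] S(2)[OF f] by eventually_elim simp
    show "AE x in N. S (\<lambda>y. c * f y) x = c * S f x"
      by (rule SI[OF range[OF _ L ae] L ae]) (intro L2_space_scale RL f)
  next
    show "\<exists>C. \<forall>f\<in>L2_range N T. L2_norm N (S f) \<le> C * L2_norm N f"
    proof (intro exI ballI)
      fix f assume f: "f \<in> L2_range N T"
      have "L2_norm N (T (S f)) = L2_norm N f"
        by (rule L2_norm_cong_AE)
          (use S(1,2)[OF f] bounded_linear_L2D(1)[OF T] RL[OF f] L2_space_measurable in auto)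
      then show "L2_norm N (S f) \<le> (1 / \<kappa>) * L2_norm N f"
        using below(2)[OF S(1)[OF f]] below(1) by (simp add: field_simps)
    qed
  qed
  moreover have "AE x in N. S (T f) x = f x" if "f \<in> L2_space N" for f
    by (rule SI[OF range[OF _ that] that]) (use bounded_linear_L2D(1)[OF T that] in auto)
  ultimately show ?thesis
    unfolding continuously_invertible_L2_def using S(2) by blast
qed

text \<open>The lower bound makes preimages of convergent images a Cauchy sequence, and continuity
  identifies the image of their limit.\<close>

lemma bounded_below_dense_range:
  assumes "finite_measure N" and dense: "L2_dense N (L2_range N T)"
  shows "L2_range N T = L2_space N"
proof
  show "L2_range N T \<subseteq> L2_space N" by (auto simp: L2_range_def)
  show "L2_space N \<subseteq> L2_range N T"
  proof
    fix g assume g: "g \<in> L2_space N"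
    have "\<exists>h\<in>L2_space N. L2_norm N (\<lambda>x. T h x - g x) < e" if "e > 0" for e
    proof -
      obtain f where f: "f \<in> L2_range N T" "L2_norm N (\<lambda>x. f x - g x) < e"
        using dense g \<open>e > 0\<close> unfolding L2_dense_def by blast
      then obtain h where h: "h \<in> L2_space N" "AE x in N. T h x = f x" "f \<in> L2_space N"
        by (auto simp: L2_range_def)
      have "L2_norm N (\<lambda>x. T h x - g x) = L2_norm N (\<lambda>x. f x - g x)"
      proof (rule L2_norm_cong_AE)
        show "(\<lambda>x. T h x - g x) \<in> borel_measurable N" "(\<lambda>x. f x - g x) \<in> borel_measurable N"
          by (intro L2_space_measurable L2_space_diff bounded_linear_L2D(1)[OF T] h g)+
        show "AE x in N. T h x - g x = f x - g x" using h(2) by eventually_elim simp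
      qed
      with f(2) h(1) show ?thesis by (intro bexI[of _ h]) simp_all
    qed
    then have "\<exists>h. h \<in> L2_space N \<and> L2_norm N (\<lambda>x. T h x - g x) < 1 / real (Suc n)" for n
      by (meson zero_less_divide_1_iff of_nat_0_less_iff zero_less_Suc)
    then obtain h where h: "\<And>n. h n \<in> L2_space N"
      "\<And>n. L2_norm N (\<lambda>x. T (h n) x - g x) < 1 / real (Suc n)"
      by metis
    have Th: "T (h n) \<in> L2_space N" for n by (rule bounded_linear_L2D(1)[OF T h(1)])
    have lim: "(\<lambda>n. L2_norm N (\<lambda>x. T (h n) x - g x)) \<longlonglongrightarrow> 0"
      by (rule tendsto_sandwich[OF _ _ tendsto_const LIMSEQ_inverse_real_of_nat])
        (use h(2) in \<open>auto simp: L2_norm_nonneg inverse_eq_divide intro!: always_eventually less_imp_le\<close>)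
    have "\<exists>f\<in>L2_space N. (\<lambda>n. L2_norm N (\<lambda>x. h n x - f x)) \<longlonglongrightarrow> 0"
    proof (rule L2_complete[OF assms(1) h(1)])
      fix e :: real assume e: "e > 0"
      \<comment> \<open>Two images closer than \<kappa> e / 2 to \<open>g\<close> are less than
        \<kappa> e apart, so their preimages are less than \<open>e\<close> apart.\<close>
      then have "0 < \<kappa> * e / 2" using below(1) by simp
      then obtain K where K: "\<And>n. n \<ge> K \<Longrightarrow> L2_norm N (\<lambda>x. T (h n) x - g x) < \<kappa> * e / 2"
        using order_tendstoD(2)[OF lim] unfolding eventually_sequentially by blast
      have "L2_norm N (\<lambda>x. h i x - h j x) < e" if "i \<ge> K" "j \<ge> K" for i j
      proof -
        have "\<kappa> * L2_norm N (\<lambda>x. h i x - h j x) \<le> L2_norm N (\<lambda>x. T (h i) x - T (h j) x)"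
          using below(2)[OF L2_space_diff[OF h(1) h(1), of i j]]
          by (simp add: bounded_linear_L2_norm_diff[OF T h(1) h(1)])
        also have "\<dots> \<le> L2_norm N (\<lambda>x. T (h i) x - g x) + L2_norm N (\<lambda>x. g x - T (h j) x)"
          by (rule L2_norm_diff_triangle[OF Th g Th])
        also have "\<dots> < \<kappa> * e"
          using K[OF that(1)] K[OF that(2)] L2_norm_minus_commute[of N g "T (h j)"] by simp
        finally show ?thesis using below(1) by simp
      qed
      then show "\<exists>K. \<forall>i\<ge>K. \<forall>j\<ge>K. L2_norm N (\<lambda>x. h i x - h j x) < e" by blast
    qed
    then obtain f where f: "f \<in> L2_space N" and hf: "(\<lambda>n. L2_norm N (\<lambda>x. h n x - f x)) \<longlonglongrightarrow> 0"
      by blast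
    have Tf: "T f \<in> L2_space N" by (rule bounded_linear_L2D(1)[OF T f])
    obtain C where C: "\<And>f. f \<in> L2_space N \<Longrightarrow> L2_norm N (T f) \<le> C * L2_norm N f"
      using T unfolding bounded_linear_L2_def by blast
    have "L2_norm N (\<lambda>x. T f x - g x) \<le> 0"
    proof (rule LIMSEQ_le_const)
      show "(\<lambda>n. C * L2_norm N (\<lambda>x. h n x - f x) + L2_norm N (\<lambda>x. T (h n) x - g x)) \<longlonglongrightarrow> 0"
        using tendsto_add[OF tendsto_mult_left[OF hf, of C] lim] by simp
      have "L2_norm N (\<lambda>x. T f x - g x)
        \<le> C * L2_norm N (\<lambda>x. h n x - f x) + L2_norm N (\<lambda>x. T (h n) x - g x)" for n
        using L2_norm_diff_triangle[OF Tf Th g, of n] C[OF L2_space_diff[OF h(1) f], of n]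
          bounded_linear_L2_norm_diff[OF T h(1) f, of n] L2_norm_minus_commute[of N "T f" "T (h n)"]
        by simp
      then show "\<exists>K. \<forall>n\<ge>K. L2_norm N (\<lambda>x. T f x - g x)
        \<le> C * L2_norm N (\<lambda>x. h n x - f x) + L2_norm N (\<lambda>x. T (h n) x - g x)" by blast
    qed
    then have "L2_norm N (\<lambda>x. T f x - g x) = 0" using L2_norm_nonneg by (rule order_antisym)
    from L2_norm_eq_0_AE[OF L2_space_diff[OF Tf g] this] f g
    show "g \<in> L2_range N T" by (auto simp: L2_range_def)
  qed
qed

end

section \<open>Transfer between the operator and the process\<close>

lemma white_noise_norm:
  assumes "prob_space M" "white_noise M N \<xi>" "\<And>i. i < (n::nat) \<Longrightarrow> h i \<in> L2_space N"
  shows "L2_norm M (\<lambda>\<omega>. \<Sum>i<n. c i * \<xi> (h i) \<omega>) = L2_norm N (\<lambda>x. \<Sum>i<n. c i * h i x)"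
    and "\<And>i. i < n \<Longrightarrow> \<xi> (h i) \<in> L2_space M"
proof -
  interpret prob_space M by fact
  have fam: "centered_gaussian_family M (L2_space N) \<xi>"
    and cov: "\<And>f g. f \<in> L2_space N \<Longrightarrow> g \<in> L2_space N \<Longrightarrow> L2_inner M (\<xi> f) (\<xi> g) = L2_inner N f g"
    using assms(2) by (auto simp: white_noise_def L2_inner_def)
  show L: "\<xi> (h i) \<in> L2_space M" if "i < n" for i
  proof (rule centered_gaussian_L2)
    show "centered_gaussian M (\<xi> (h i))"
      using fam[unfolded centered_gaussian_family_def, rule_format, of "{h i}" "\<lambda>_. 1"] assms(3)[OF that]
      by simp
  qed
  show "L2_norm M (\<lambda>\<omega>. \<Sum>i<n. c i * \<xi> (h i) \<omega>) = L2_norm N (\<lambda>x. \<Sum>i<n. c i * h i x)"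
    unfolding L2_norm_def
    by (subst (1 2) L2_inner_sum_sum) (auto simp: L assms(3) cov)
qed

text \<open>The link between the operator and the heat equation: linearity takes \<open>A\<close>
  through the finite sum, and white noise maps L2 isometrically to random variables.\<close>

lemma generates_integrator_norm:
  assumes "prob_space M" "generates_integrator M a b A y" "\<And>i. i < (n::nat) \<Longrightarrow> u i \<in> {a..b}"
    and [measurable]: "\<And>i. i < n \<Longrightarrow> y (u i) \<in> borel_measurable M"
  shows "L2_norm (interval_lborel a b) (A (\<lambda>x. \<Sum>i<n. c i * indicator {a..u i} x))
    = L2_norm M (\<lambda>\<omega>. \<Sum>i<n. c i * y (u i) \<omega>)"
proof -
  let ?N = "interval_lborel a b"
  obtain \<xi> where A: "bounded_linear_L2 ?N (L2_space ?N) A" and \<xi>: "white_noise M ?N \<xi>"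
    and y: "\<And>u. u \<in> {a..b} \<Longrightarrow> AE \<omega> in M. y u \<omega> = \<xi> (A (indicator {a..u})) \<omega>"
    using assms(2) unfolding generates_integrator_def by blast
  have AL: "A (indicator {a..u i}) \<in> L2_space ?N" for i
    by (rule bounded_linear_L2D(1)[OF A indicator_interval_L2])
  note wn = white_noise_norm[OF assms(1) \<xi>, of n "\<lambda>i. A (indicator {a..u i})", OF AL]
  have sL: "(\<lambda>x. \<Sum>i<n. c i * indicator {a..u i} x) \<in> L2_space ?N"
    by (intro L2_space_sum L2_space_scale indicator_interval_L2)
  have "L2_norm ?N (A (\<lambda>x. \<Sum>i<n. c i * indicator {a..u i} x))
    = L2_norm ?N (\<lambda>x. \<Sum>i<n. c i * A (indicator {a..u i}) x)"
  proof (rule L2_norm_cong_AE)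
    show "A (\<lambda>x. \<Sum>i<n. c i * indicator {a..u i} x) \<in> borel_measurable ?N"
      by (rule L2_space_measurable[OF bounded_linear_L2D(1)[OF A sL]])
    show "(\<lambda>x. \<Sum>i<n. c i * A (indicator {a..u i}) x) \<in> borel_measurable ?N"
      by (intro L2_space_measurable L2_space_sum L2_space_scale AL)
    show "AE x in ?N. A (\<lambda>x. \<Sum>i<n. c i * indicator {a..u i} x) x = (\<Sum>i<n. c i * A (indicator {a..u i}) x)"
      by (rule bounded_linear_L2_sum[OF A indicator_interval_L2])
  qed
  also have "\<dots> = L2_norm M (\<lambda>\<omega>. \<Sum>i<n. c i * \<xi> (A (indicator {a..u i})) \<omega>)"
    by (rule wn(1)[symmetric])
  also have "\<dots> = L2_norm M (\<lambda>\<omega>. \<Sum>i<n. c i * y (u i) \<omega>)"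
  proof (rule L2_norm_cong_AE)
    show "(\<lambda>\<omega>. \<Sum>i<n. c i * \<xi> (A (indicator {a..u i})) \<omega>) \<in> borel_measurable M"
      using wn(2) L2_space_measurable by (intro borel_measurable_sum borel_measurable_times) auto
    have "AE \<omega> in M. \<forall>i\<in>{..<n}. y (u i) \<omega> = \<xi> (A (indicator {a..u i})) \<omega>"
      using y assms(3) by (intro AE_finite_allI) auto
    then show "AE \<omega> in M. (\<Sum>i<n. c i * \<xi> (A (indicator {a..u i})) \<omega>) = (\<Sum>i<n. c i * y (u i) \<omega>)"
      by eventually_elim simp
  qed simp
  finally show ?thesis .
qed

text \<open>Both sides are continuous in mean square, so density of the step functions suffices. It
  holds because their closure meets the conditions of \<open>L2_interval_induct\<close>.\<close>

lemma L2_bounded_below_of_step: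
  assumes "a \<le> b" and A: "bounded_linear_L2 (interval_lborel a b) (L2_space (interval_lborel a b)) A"
    and "0 \<le> \<kappa>"
    and step: "\<And>n u c. (\<And>i. i < (n::nat) \<Longrightarrow> u i \<in> {a..b}) \<Longrightarrow>
      \<kappa> * L2_norm (interval_lborel a b) (\<lambda>x. \<Sum>i<n. c i * indicator {a..u i} x)
      \<le> L2_norm (interval_lborel a b) (A (\<lambda>x. \<Sum>i<n. c i * indicator {a..u i} x))"
    and f: "f \<in> L2_space (interval_lborel a b)"
  shows "\<kappa> * L2_norm (interval_lborel a b) f \<le> L2_norm (interval_lborel a b) (A f)"
proof -
  let ?N = "interval_lborel a b"
  define Step where "Step s \<longleftrightarrow> (\<exists>(n::nat) u c. (\<forall>i<n. u i \<in> {a..b}) \<and>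
      s = (\<lambda>x. \<Sum>i<n. c i * indicator {a..u i} x :: real))" for s
  have StepL: "s \<in> L2_space ?N" if "Step s" for s
  proof -
    obtain n u c where "s = (\<lambda>x. \<Sum>i<(n::nat). c i * indicator {a..u i} x)"
      using \<open>Step s\<close> unfolding Step_def by blast
    then show ?thesis by (simp only: L2_space_sum L2_space_scale indicator_interval_L2)
  qed
  have Step_scale: "Step (\<lambda>x. r * s x)" if "Step s" for s r
  proof -
    obtain n u c where "\<forall>i<(n::nat). u i \<in> {a..b}" "s = (\<lambda>x. \<Sum>i<n. c i * indicator {a..u i} x)"
      using \<open>Step s\<close> unfolding Step_def by blast
    then have "\<forall>i<n. u i \<in> {a..b}"
      "(\<lambda>x. r * s x) = (\<lambda>x. \<Sum>i<n. r * c i * indicator {a..u i} x)"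
      by (simp_all only: sum_distrib_left mult.assoc)
    then show ?thesis unfolding Step_def by (intro exI conjI)
  qed
  have Step_add: "Step (\<lambda>x. s x + t x)" if "Step s" "Step t" for s t
  proof -
    obtain n u c where 1: "\<forall>i<(n::nat). u i \<in> {a..b}" "s = (\<lambda>x. \<Sum>i<n. c i * indicator {a..u i} x)"
      using \<open>Step s\<close> unfolding Step_def by blast
    obtain m v d where 2: "\<forall>i<(m::nat). v i \<in> {a..b}" "t = (\<lambda>x. \<Sum>i<m. d i * indicator {a..v i} x)"
      using \<open>Step t\<close> unfolding Step_def by blast
    let ?w = "\<lambda>i. if i < n then u i else v (i - n)" and ?e = "\<lambda>i. if i < n then c i else d (i - n)"
    have "(\<lambda>x. s x + t x) = (\<lambda>x. \<Sum>i<n + m. ?e i * indicator {a..?w i} x)"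
    proof
      fix x
      have "(\<Sum>i<n + m. ?e i * indicator {a..?w i} x) = (\<Sum>i<n + m. if i < n
        then c i * indicator {a..u i} x else d (i - n) * indicator {a..v (i - n)} x)"
        by (intro sum.cong) auto
      also have "\<dots> = s x + t x" unfolding 1 2 by (rule sum_lessThan_append)
      finally show "s x + t x = (\<Sum>i<n + m. ?e i * indicator {a..?w i} x)" by simp
    qed
    moreover have "\<forall>i<n + m. ?w i \<in> {a..b}" using 1(1) 2(1) by auto
    ultimately show ?thesis unfolding Step_def by (intro exI conjI)
  qed
  define V where "V = {g \<in> L2_space ?N. \<forall>e>0. \<exists>s. Step s \<and> L2_norm ?N (\<lambda>x. s x - g x) < e}"
  have "f \<in> V"
  proof (rule L2_interval_induct[OF \<open>a \<le> b\<close> f])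
    fix u assume "u \<in> {a..b}"
    then have "Step (indicator {a..u})"
      unfolding Step_def by (intro exI[of _ 1] exI[of _ "\<lambda>_. u"] exI[of _ "\<lambda>_. 1"]) auto
    then show "indicator {a..u} \<in> V"
      by (auto simp: V_def indicator_interval_L2 L2_norm_def L2_inner_def intro!: exI[of _ "indicator {a..u}"])
  next
    fix c g assume g: "g \<in> V"
    have "\<exists>s. Step s \<and> L2_norm ?N (\<lambda>x. s x - c * g x) < e" if e: "e > 0" for e
    proof -
      \<comment> \<open>The added 1 covers c = 0.\<close>
      have "e / (\<bar>c\<bar> + 1) > 0" using e by simp
      then obtain s where s: "Step s" "L2_norm ?N (\<lambda>x. s x - g x) < e / (\<bar>c\<bar> + 1)"
        using g unfolding V_def by blast
      have "L2_norm ?N (\<lambda>x. c * s x - c * g x) = \<bar>c\<bar> * L2_norm ?N (\<lambda>x. s x - g x)"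
        by (simp add: right_diff_distrib[symmetric] L2_norm_scale)
      also have "\<dots> \<le> (\<bar>c\<bar> + 1) * L2_norm ?N (\<lambda>x. s x - g x)"
        by (intro mult_right_mono L2_norm_nonneg) simp
      also have "\<dots> < e" using s(2) by (simp add: field_simps)
      finally show ?thesis using Step_scale[OF s(1)] by blast
    qed
    then show "(\<lambda>x. c * g x) \<in> V" using g by (simp add: V_def L2_space_scale)
  next
    fix g h assume gh: "g \<in> V" "h \<in> V"
    have L: "g \<in> L2_space ?N" "h \<in> L2_space ?N" using gh by (auto simp: V_def)
    have "\<exists>s. Step s \<and> L2_norm ?N (\<lambda>x. s x - (g x + h x)) < e" if e: "e > 0" for e
    proof -
      have "e / 2 > 0" using e by simp
      then obtain s t where s: "Step s" "L2_norm ?N (\<lambda>x. s x - g x) < e / 2"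
        and t: "Step t" "L2_norm ?N (\<lambda>x. t x - h x) < e / 2"
        using gh unfolding V_def by blast
      have "L2_norm ?N (\<lambda>x. (s x + t x) - (g x + h x)) < e"
        using L2_norm_triangle[OF L2_space_diff[OF StepL[OF s(1)] L(1)] L2_space_diff[OF StepL[OF t(1)] L(2)]] s t
        by (simp add: algebra_simps)
      then show ?thesis using Step_add[OF s(1) t(1)] by blast
    qed
    then show "(\<lambda>x. g x + h x) \<in> V" using L by (simp add: V_def L2_space_add)
  next
    fix F g assume F: "\<And>k::nat. F k \<in> V" and g: "g \<in> L2_space ?N"
      and lim: "(\<lambda>k. L2_norm ?N (\<lambda>x. F k x - g x)) \<longlonglongrightarrow> 0"
    have "\<exists>s. Step s \<and> L2_norm ?N (\<lambda>x. s x - g x) < e" if e: "e > 0" for e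
    proof -
      have e2: "e / 2 > 0" using e by simp
      obtain k where k: "L2_norm ?N (\<lambda>x. F k x - g x) < e / 2"
        using order_tendstoD(2)[OF lim e2] unfolding eventually_sequentially by blast
      obtain s where s: "Step s" "L2_norm ?N (\<lambda>x. s x - F k x) < e / 2" "F k \<in> L2_space ?N"
        using F[of k] e2 unfolding V_def by blast
      have "L2_norm ?N (\<lambda>x. s x - g x) < e"
        using L2_norm_diff_triangle[OF StepL[OF s(1)] s(3) g] k s(2) by simp
      with s(1) show ?thesis by blast
    qed
    then show "g \<in> V" using g by (simp add: V_def)
  qed
  obtain C where C: "\<And>f. f \<in> L2_space ?N \<Longrightarrow> L2_norm ?N (A f) \<le> C * L2_norm ?N f"
    using A unfolding bounded_linear_L2_def by blast
  show ?thesis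
  proof (rule field_le_epsilon)
    fix e :: real assume e: "e > 0"
    \<comment> \<open>With \<open>s\<close> at distance d from \<open>f\<close>, replacing
      \<open>f\<close> by \<open>s\<close> costs at most \<kappa> d on one side and \<bar>C\<bar> d
      on the other. The absolute value is taken because the sign of \<open>C\<close> is unknown, and
      the 1 keeps the denominator positive.\<close>
    have "e / (\<bar>C\<bar> + \<kappa> + 1) > 0" using e \<open>0 \<le> \<kappa>\<close> by simp
    then obtain s where s: "Step s" and d: "L2_norm ?N (\<lambda>x. s x - f x) < e / (\<bar>C\<bar> + \<kappa> + 1)"
      using \<open>f \<in> V\<close> unfolding V_def by blast
    let ?d = "L2_norm ?N (\<lambda>x. s x - f x)"
    have sL: "s \<in> L2_space ?N" by (rule StepL[OF s])
    have AsL: "A s \<in> L2_space ?N" "A f \<in> L2_space ?N"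
      using bounded_linear_L2D(1)[OF A] sL f by auto
    have "\<kappa> * L2_norm ?N s \<le> L2_norm ?N (A s)"
      using s step unfolding Step_def by auto
    moreover have "L2_norm ?N (A s) \<le> L2_norm ?N (A f) + \<bar>C\<bar> * ?d"
    proof -
      have "L2_norm ?N (A s) - L2_norm ?N (A f) \<le> L2_norm ?N (A (\<lambda>x. s x - f x))"
        using L2_norm_reverse_triangle[OF AsL] bounded_linear_L2_norm_diff[OF A sL f] by simp
      also have "\<dots> \<le> C * ?d" by (rule C[OF L2_space_diff[OF sL f]])
      also have "\<dots> \<le> \<bar>C\<bar> * ?d" by (intro mult_right_mono L2_norm_nonneg) simp
      finally show ?thesis by simp
    qed
    moreover have "\<kappa> * L2_norm ?N f \<le> \<kappa> * (L2_norm ?N s + ?d)"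
      using L2_norm_reverse_triangle[OF sL f] \<open>0 \<le> \<kappa>\<close> by (intro mult_left_mono) auto
    moreover have "(\<bar>C\<bar> + \<kappa>) * ?d \<le> e"
    proof -
      have "(\<bar>C\<bar> + \<kappa>) * ?d \<le> (\<bar>C\<bar> + \<kappa> + 1) * ?d"
        by (intro mult_right_mono L2_norm_nonneg) simp
      also have "\<dots> \<le> (\<bar>C\<bar> + \<kappa> + 1) * (e / (\<bar>C\<bar> + \<kappa> + 1))"
        using d \<open>0 \<le> \<kappa>\<close> by (intro mult_left_mono) auto
      also have "\<dots> = e" using \<open>0 \<le> \<kappa>\<close> by (simp add: field_simps add_nonneg_pos)
      finally show ?thesis .
    qed
    ultimately show "\<kappa> * L2_norm ?N f \<le> L2_norm ?N (A f) + e"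
      by (simp add: algebra_simps)
  qed
qed

text \<open>An isometry on the left changes \<open>A\<close> but not the law of the process, and it
  may make the range a proper subspace. Being onto is therefore claimed only under density of the
  range.\<close>

theorem lemma2p1:
  fixes M :: "'w measure"
    and W :: "(real \<times> real) set \<Rightarrow> 'w \<Rightarrow> real"
    and x :: "real \<Rightarrow> 'w \<Rightarrow> real"
    and U1 U2 :: real
  assumes "U1 < U2" and "U2 - U1 < 2 * sqrt pi"
    and "prob_space M"
    and "gaussian_random_measure M (restrict_space lborel (UNIV \<times> {0..1})) W"
    and "\<And>u. u \<in> {U1..U2} \<Longrightarrow>
           has_noise_integral M (restrict_space lborel (UNIV \<times> {0..1})) W
             (\<lambda>(v, s). heat_kernel (1 - s) (u - v)) (x u)"
  shows "gaussian_integrator M U1 U2 (\<lambda>u \<omega>. x u \<omega> - x U1 \<omega>) \<and>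
    (\<forall>A. generates_integrator M U1 U2 A (\<lambda>u \<omega>. x u \<omega> - x U1 \<omega>) \<longrightarrow>
       continuously_invertible_L2 (interval_lborel U1 U2) A \<and>
       (L2_dense (interval_lborel U1 U2) (L2_range (interval_lborel U1 U2) A) \<longrightarrow>
          L2_range (interval_lborel U1 U2) A = L2_space (interval_lborel U1 U2)))"
proof -
  have gm: "gaussian_measure M (restrict_space lborel (UNIV \<times> {0..1})) W"
    using assms(3,4) by (simp add: gaussian_measure_def gaussian_measure_axioms_def)
  have U: "U1 \<le> U2" using assms(1) by simp
  let ?N = "interval_lborel U1 U2"
  \<comment> \<open>The length of the interval times the maximum of the kernel, that is, the
    relative size of the perturbation; the length hypothesis says that it is below 1.\<close>
  define \<delta> where "\<delta> = (U2 - U1) / (2 * sqrt pi)"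
  have \<delta>: "\<delta> < 1" using assms(2) by (simp add: \<delta>_def divide_less_eq)
  have "continuously_invertible_L2 ?N A \<and>
       (L2_dense ?N (L2_range ?N A) \<longrightarrow> L2_range ?N A = L2_space ?N)"
    if A: "generates_integrator M U1 U2 A (\<lambda>u \<omega>. x u \<omega> - x U1 \<omega>)" for A
  proof -
    have lin: "bounded_linear_L2 ?N (L2_space ?N) A"
      using A by (simp add: generates_integrator_def)
    have meas: "(\<lambda>\<omega>. x u \<omega> - x U1 \<omega>) \<in> borel_measurable M" if "u \<in> {U1..U2}" for u
      using assms(5)[OF that] assms(5)[of U1] U
      by (auto simp: has_noise_integral_def dest!: L2_space_measurable)
    have below: "sqrt (1 - \<delta>) * L2_norm ?N f \<le> L2_norm ?N (A f)" if "f \<in> L2_space ?N" for f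
    proof (rule L2_bounded_below_of_step[OF U lin _ _ that])
      show "0 \<le> sqrt (1 - \<delta>)" using \<delta> by simp
      fix n :: nat and u c :: "nat \<Rightarrow> real" assume u: "\<And>i. i < n \<Longrightarrow> u i \<in> {U1..U2}"
      let ?f = "\<lambda>x. \<Sum>i<n. c i * indicator {U1..u i} x"
      have "\<bar>(L2_norm ?N (A ?f))\<^sup>2 - (L2_norm ?N ?f)\<^sup>2\<bar> \<le> \<delta> * (L2_norm ?N ?f)\<^sup>2"
      proof -
        have "L2_norm ?N (A ?f) = L2_norm M (\<lambda>\<omega>. \<Sum>i<n. c i * (x (u i) \<omega> - x U1 \<omega>))"
          by (rule generates_integrator_norm[OF assms(3) A u]) (use u meas in auto)
        then show ?thesis
          unfolding \<delta>_def by (simp only:) (rule heat_increment_norm(2)[OF gm U assms(5)], use u in auto)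
      qed
      \<comment> \<open>The lower half of the two-sided estimate; its square root is the lower bound
        with constant sqrt (1 - \<delta>).\<close>
      then have "(1 - \<delta>) * (L2_norm ?N ?f)\<^sup>2 \<le> (L2_norm ?N (A ?f))\<^sup>2"
        by (simp add: left_diff_distrib)
      then have "(sqrt (1 - \<delta>) * L2_norm ?N ?f)\<^sup>2 \<le> (L2_norm ?N (A ?f))\<^sup>2"
        using \<delta> by (simp add: power_mult_distrib)
      then show "sqrt (1 - \<delta>) * L2_norm ?N ?f \<le> L2_norm ?N (A ?f)"
        by (rule power2_le_imp_le) (rule L2_norm_nonneg)
    qed
    have "sqrt (1 - \<delta>) > 0" using \<delta> by simp
    note b = lin this below
    show ?thesis
      using bounded_below_continuously_invertible[OF b] bounded_below_dense_range[OF b]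
        finite_measure_interval_lborel by blast
  qed
  then show ?thesis using heat_gaussian_integrator[OF gm U assms(5)] by blast
qed

end
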